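(* Let $e_0,e_3,e_4\in\mathbb{C}^*$ satisfy $e_0\neq\pm1$, $e_3\neq\pm1$, $e_4\neq\pm1$ and $e_0e_3^{\varepsilon_3}e_4^{\varepsilon_4}\neq1$ for all $\varepsilon_3,\varepsilon_4\in\{1,-1\}$. On the cubic surface $\mathcal{C}_V(\theta)$ let $y_1=x_1$, $y_2=x_2$ and $z_1=\partial F_V/\partial x_3=x_1x_2-e_0$. Then the pairs $(y_1,z_1)$ and $(z_1,y_2)$ are log-canonical systems of coordinates on $\mathcal{C}_V(\theta)$. Moreover, a rational function $z$ such that both $(y_1,z)$ and $(z,y_2)$ are log-canonical systems of coordinates is unique up to a multiplicative constant, i.e. $z=cz_1$ for some $c\in\mathbb{C}^*$.
   Context: $a_3=e_3+e_3^{-1}$, $a_4=e_4+e_4^{-1}$, $\theta_1=a_3+e_0a_4$, $\theta_2=a_4+e_0a_3$, $\theta_3=e_0$, $\theta_4=e_0^2+e_0a_3a_4+1$; $\mathcal{C}_V(\theta)\subset\mathbb{C}^3$ is the surface $F_V=x_1x_2x_3+x_1^2+x_2^2-\theta_1x_1-\theta_2x_2-\theta_3x_3+\theta_4=0$, endowed with the $2$-form $\omega_V=\frac{dx_1\wedge dx_2}{\partial F_V/\partial x_3}=\frac{dx_2\wedge dx_3}{\partial F_V/\partial x_1}=\frac{dx_3\wedge dx_1}{\partial F_V/\partial x_2}$. A log-canonical system of coordinates on $\mathcal{C}_V(\theta)$ is a pair $(u,v)$ of rational functions such that $(u,v):\mathcal{C}_V(\theta)\to\mathbb{C}^2$ is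 birational and $\frac{du}{u}\wedge\frac{dv}{v}=\omega_V$. *)

theory Defs
  imports "HOL-Analysis.Analysis" "HOL-Algebra.Ring"
begin

section \<open>Polynomial functions and the Zariski topology\<close>

text \<open>As the complex numbers are infinite, polynomials in the coordinates of
  affine \<open>n\<close>-space are the same as polynomial functions.\<close>

inductive polyfun :: "(complex ^ 'n \<Rightarrow> complex) \<Rightarrow> bool" where
  const: "polyfun (\<lambda>x. c)"
| coord: "polyfun (\<lambda>x. x $ i)"
| add: "polyfun p \<Longrightarrow> polyfun q \<Longrightarrow> polyfun (\<lambda>x. p x + q x)"
| mult: "polyfun p \<Longrightarrow> polyfun q \<Longrightarrow> polyfun (\<lambda>x. p x * q x)"

definition zariski_openin :: "(complex ^ 'n) set \<Rightarrow> (complex ^ 'n) set \<Rightarrow> bool" where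
  "zariski_openin X U \<longleftrightarrow>
     (\<exists>A. (\<forall>p\<in>A. polyfun p) \<and> U = {x \<in> X. \<exists>p\<in>A. p x \<noteq> 0})"

definition partial_deriv ::
  "'n \<Rightarrow> (complex ^ 'n \<Rightarrow> complex) \<Rightarrow> complex ^ 'n \<Rightarrow> complex" where
  "partial_deriv i p x = deriv (\<lambda>t. p (\<chi> j. if j = i then t else x $ j)) (x $ i)"

section \<open>The field of rational functions of an irreducible affine variety\<close>

text \<open>A rational function on \<open>X\<close> is an equivalence class of fractions \<open>a / b\<close> of polynomials, where
  \<open>b\<close> does not vanish identically on \<open>X\<close>. The relation is cross-multiplication in the
  coordinate ring of \<open>X\<close>; it is an equivalence relation when \<open>X\<close> is irreducible.\<close>

type_synonym 'n ratfun = "((complex ^ 'n \<Rightarrow> complex) \<times> (complex ^ 'n \<Rightarrow> complex)) set"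

definition fractions :: "(complex ^ 'n) set \<Rightarrow> 'n ratfun" where
  "fractions X = {(a, b). polyfun a \<and> polyfun b \<and> (\<exists>x\<in>X. b x \<noteq> 0)}"

definition frac_class ::
  "(complex ^ 'n) set \<Rightarrow> (complex ^ 'n \<Rightarrow> complex) \<Rightarrow> (complex ^ 'n \<Rightarrow> complex) \<Rightarrow> 'n ratfun" where
  "frac_class X a b = {(c, d) \<in> fractions X. \<forall>x\<in>X. a x * d x = c x * b x}"

definition function_field :: "(complex ^ 'n) set \<Rightarrow> 'n ratfun ring" where
  "function_field X =
    \<lparr>carrier = {frac_class X a b | a b. (a, b) \<in> fractions X},
     mult = (\<lambda>f g. \<Union>(a, b)\<in>f. \<Union>(c, d)\<in>g. frac_class X (\<lambda>x. a x * c x) (\<lambda>x. b x * d x)),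
     one = frac_class X (\<lambda>x. 1) (\<lambda>x. 1),
     zero = frac_class X (\<lambda>x. 0) (\<lambda>x. 1),
     add = (\<lambda>f g. \<Union>(a, b)\<in>f. \<Union>(c, d)\<in>g.
              frac_class X (\<lambda>x. a x * d x + c x * b x) (\<lambda>x. b x * d x))\<rparr>"

definition rat_of_polyfun :: "(complex ^ 'n) set \<Rightarrow> (complex ^ 'n \<Rightarrow> complex) \<Rightarrow> 'n ratfun" where
  "rat_of_polyfun X p = frac_class X p (\<lambda>x. 1)"

definition rat_const :: "(complex ^ 'n) set \<Rightarrow> complex \<Rightarrow> 'n ratfun" where
  "rat_const X c = rat_of_polyfun X (\<lambda>x. c)"

definition rat_coord :: "(complex ^ 'n) set \<Rightarrow> 'n \<Rightarrow> 'n ratfun" where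
  "rat_coord X i = rat_of_polyfun X (\<lambda>x. x $ i)"

definition rat_dom :: "(complex ^ 'n) set \<Rightarrow> 'n ratfun \<Rightarrow> (complex ^ 'n) set" where
  "rat_dom X f = {x \<in> X. \<exists>(a, b)\<in>f. b x \<noteq> 0}"

definition rat_val :: "'n ratfun \<Rightarrow> complex ^ 'n \<Rightarrow> complex" where
  "rat_val f x = (THE w. \<exists>(a, b)\<in>f. b x \<noteq> 0 \<and> w = a x / b x)"

section \<open>Rational and birational maps\<close>

definition ratmap_dom :: "(complex ^ 'n) set \<Rightarrow> ('m \<Rightarrow> 'n ratfun) \<Rightarrow> (complex ^ 'n) set" where
  "ratmap_dom X \<phi> = {x \<in> X. \<forall>i. x \<in> rat_dom X (\<phi> i)}"

definition ratmap_val :: "('m \<Rightarrow> 'n ratfun) \<Rightarrow> complex ^ 'n \<Rightarrow> complex ^ 'm" where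
  "ratmap_val \<phi> x = (\<chi> i. rat_val (\<phi> i) x)"

definition rational_map ::
  "(complex ^ 'n) set \<Rightarrow> (complex ^ 'm) set \<Rightarrow> ('m \<Rightarrow> 'n ratfun) \<Rightarrow> bool" where
  "rational_map X Y \<phi> \<longleftrightarrow>
     (\<forall>i. \<phi> i \<in> carrier (function_field X)) \<and>
     (\<forall>x\<in>ratmap_dom X \<phi>. ratmap_val \<phi> x \<in> Y)"

text \<open>The composition of \<open>\<phi>\<close> from \<open>X\<close> to \<open>Y\<close> and \<open>\<psi>\<close> from \<open>Y\<close> to \<open>X\<close> is defined and is the
  identity as a rational map of \<open>X\<close>, that is, on a nonempty Zariski open set.\<close>

definition ratmap_comp_id ::
  "(complex ^ 'n) set \<Rightarrow> (complex ^ 'm) set \<Rightarrow> ('m \<Rightarrow> 'n ratfun) \<Rightarrow> ('n \<Rightarrow> 'm ratfun) \<Rightarrow> bool" where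
  "ratmap_comp_id X Y \<phi> \<psi> \<longleftrightarrow>
     (\<exists>U. zariski_openin X U \<and> U \<noteq> {} \<and>
       (\<forall>x\<in>U. x \<in> ratmap_dom X \<phi> \<and> ratmap_val \<phi> x \<in> ratmap_dom Y \<psi> \<and>
               ratmap_val \<psi> (ratmap_val \<phi> x) = x))"

definition birational_map ::
  "(complex ^ 'n) set \<Rightarrow> (complex ^ 'm) set \<Rightarrow> ('m \<Rightarrow> 'n ratfun) \<Rightarrow> bool" where
  "birational_map X Y \<phi> \<longleftrightarrow> rational_map X Y \<phi> \<and>
     (\<exists>\<psi>. rational_map Y X \<psi> \<and> ratmap_comp_id X Y \<phi> \<psi> \<and> ratmap_comp_id Y X \<psi> \<phi>)"

section \<open>Rational differential forms\<close>

text \<open>Rational vector fields on \<open>X\<close> are the derivations over the complex numbers of the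
  function field. Rational \<open>k\<close>-forms are alternating \<open>k\<close>-linear functions of \<open>k\<close> vector fields
  with values in the function field, and are represented here by functions restricted to
  the vector fields, so that equality of forms is equality in HOL.\<close>

type_synonym 'n vfield = "'n ratfun \<Rightarrow> 'n ratfun"
type_synonym 'n form1 = "'n vfield \<Rightarrow> 'n ratfun"
type_synonym 'n form2 = "'n vfield \<times> 'n vfield \<Rightarrow> 'n ratfun"

definition derivations :: "(complex ^ 'n) set \<Rightarrow> 'n vfield set" where
  "derivations X = (let K = function_field X in
     {D \<in> carrier K \<rightarrow> carrier K.
        (\<forall>f\<in>carrier K. \<forall>g\<in>carrier K. D (f \<oplus>\<^bsub>K\<^esub> g) = D f \<oplus>\<^bsub>K\<^esub> D g) \<and>
        (\<forall>f\<in>carrier K. \<forall>g\<in>carrier K.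
           D (f \<otimes>\<^bsub>K\<^esub> g) = (f \<otimes>\<^bsub>K\<^esub> D g) \<oplus>\<^bsub>K\<^esub> (g \<otimes>\<^bsub>K\<^esub> D f)) \<and>
        (\<forall>c. D (rat_const X c) = \<zero>\<^bsub>K\<^esub>)})"

definition differential :: "(complex ^ 'n) set \<Rightarrow> 'n ratfun \<Rightarrow> 'n form1" where
  "differential X f = (\<lambda>D\<in>derivations X. D f)"

definition wedge :: "(complex ^ 'n) set \<Rightarrow> 'n form1 \<Rightarrow> 'n form1 \<Rightarrow> 'n form2" where
  "wedge X \<alpha> \<beta> = (let K = function_field X in
     restrict (\<lambda>(D, E). (\<alpha> D \<otimes>\<^bsub>K\<^esub> \<beta> E) \<ominus>\<^bsub>K\<^esub> (\<alpha> E \<otimes>\<^bsub>K\<^esub> \<beta> D))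
       (derivations X \<times> derivations X))"

definition div_form1 :: "(complex ^ 'n) set \<Rightarrow> 'n form1 \<Rightarrow> 'n ratfun \<Rightarrow> 'n form1" where
  "div_form1 X \<alpha> f = (let K = function_field X in
     (\<lambda>D\<in>derivations X. inv\<^bsub>K\<^esub> f \<otimes>\<^bsub>K\<^esub> \<alpha> D))"

definition div_form2 :: "(complex ^ 'n) set \<Rightarrow> 'n form2 \<Rightarrow> 'n ratfun \<Rightarrow> 'n form2" where
  "div_form2 X \<omega> f = (let K = function_field X in
     (\<lambda>P\<in>derivations X \<times> derivations X. inv\<^bsub>K\<^esub> f \<otimes>\<^bsub>K\<^esub> \<omega> P))"

definition dlog :: "(complex ^ 'n) set \<Rightarrow> 'n ratfun \<Rightarrow> 'n form1" where
  "dlog X f = div_form1 X (differential X f) f"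

definition log_canonical ::
  "(complex ^ 'n) set \<Rightarrow> 'n form2 \<Rightarrow> 'n ratfun \<Rightarrow> 'n ratfun \<Rightarrow> bool" where
  "log_canonical X \<omega> u v \<longleftrightarrow>
     u \<in> carrier (function_field X) \<and> v \<in> carrier (function_field X) \<and>
     birational_map X (UNIV :: (complex ^ 2) set) (\<lambda>i. if i = 1 then u else v) \<and>
     wedge X (dlog X u) (dlog X v) = \<omega>"

section \<open>The cubic surface\<close>

definition F_poly ::
  "complex \<Rightarrow> complex \<Rightarrow> complex \<Rightarrow> complex \<Rightarrow> complex ^ 3 \<Rightarrow> complex" where
  "F_poly \<theta>1 \<theta>2 \<theta>3 \<theta>4 x =
     x$1 * x$2 * x$3 + (x$1)^2 + (x$2)^2 - \<theta>1 * x$1 - \<theta>2 * x$2 - \<theta>3 * x$3 + \<theta>4"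

definition F_V :: "complex \<Rightarrow> complex \<Rightarrow> complex \<Rightarrow> complex ^ 3 \<Rightarrow> complex" where
  "F_V e0 e3 e4 = (let a3 = e3 + inverse e3; a4 = e4 + inverse e4 in
     F_poly (a3 + e0 * a4) (a4 + e0 * a3) e0 (e0^2 + e0 * a3 * a4 + 1))"

definition C_V :: "complex \<Rightarrow> complex \<Rightarrow> complex \<Rightarrow> (complex ^ 3) set" where
  "C_V e0 e3 e4 = {x. F_V e0 e3 e4 x = 0}"

text \<open>The form \<open>dx\<^sub>1 \<and> dx\<^sub>2 / (\<partial>F/\<partial>x\<^sub>3)\<close>. The other two expressions, obtained by cyclic permutation
  of the coordinates, are equal to it because \<open>dF = 0\<close> on the surface.\<close>

definition omega_V :: "complex \<Rightarrow> complex \<Rightarrow> complex \<Rightarrow> 3 form2" where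
  "omega_V e0 e3 e4 = (let X = C_V e0 e3 e4 in
     div_form2 X
       (wedge X (differential X (rat_coord X 1)) (differential X (rat_coord X 2)))
       (rat_of_polyfun X (partial_deriv 3 (F_V e0 e3 e4))))"

end

theory Submission
  imports Defs
begin

text \<open>Write \<open>F = p x\<^sub>3 + q(x\<^sub>1, x\<^sub>2)\<close> with \<open>p = x\<^sub>1 x\<^sub>2 - e\<^sub>0 = \<partial>F/\<partial>x\<^sub>3\<close>. Where \<open>p\<close> does not vanish the surface
  is the graph of \<open>- q/p\<close>, so that \<open>(x\<^sub>1, x\<^sub>2)\<close> are birational coordinates and the function field is
  that of the plane. In these coordinates
  \<open>dx\<^sub>1/x\<^sub>1 \<and> dp/p = dx\<^sub>1/x\<^sub>1 \<and> x\<^sub>1 dx\<^sub>2/p = dx\<^sub>1 \<and> dx\<^sub>2/p = \<omega>\<close>, and similarly for \<open>(p, x\<^sub>2)\<close>; both pairs are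
  birational because \<open>p + e\<^sub>0 = x\<^sub>1 x\<^sub>2\<close> gives back the missing coordinate
  (\<open>birational_via_plane\<close>, \<open>wedge_y1_z1\<close>, \<open>wedge_z1_y2\<close>).

  For uniqueness, \<open>dx\<^sub>1/x\<^sub>1 \<and> dz/z = \<omega>\<close> says that \<open>\<partial>z/\<partial>x\<^sub>2 = (x\<^sub>1/p) z\<close>, and \<open>dz/z \<and> dx\<^sub>2/x\<^sub>2 = \<omega>\<close> says that
  \<open>\<partial>z/\<partial>x\<^sub>1 = (x\<^sub>2/p) z\<close>. These are the logarithmic derivatives of \<open>p\<close>, so both derivatives of \<open>z/p\<close>
  vanish and \<open>z/p\<close> is constant (\<open>unique_up_to_constant\<close>).

  The part of the surface outside the chart has to be controlled before any of this makes sense: the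
  set of points must be irreducible for its fractions to form a field. The points with \<open>p = 0\<close> are
  those with \<open>x\<^sub>1 x\<^sub>2 = e\<^sub>0\<close> and \<open>q = 0\<close>, where \<open>x\<^sub>3\<close> is free. On the hyperbola \<open>x\<^sub>1 x\<^sub>2 = e\<^sub>0\<close> the polynomial \<open>q\<close>
  factors as \<open>(x\<^sub>1 - e\<^sub>3) (x\<^sub>1 - 1/e\<^sub>3) (x\<^sub>2 - e\<^sub>4) (x\<^sub>2 - 1/e\<^sub>4)\<close>, and the hypotheses on the parameters make the
  four zeros distinct. Hence \<open>p\<close> and \<open>q\<close> have independent differentials there, and \<open>- q/p\<close> takes any
  prescribed limit \<open>x\<^sub>3\<close> along a suitable line through the zero (\<open>chart_dense\<close>). So polynomials that vanish
  on the chart vanish on the surface, and irreducibility follows from that of the plane.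

  The partial derivatives with respect to \<open>x\<^sub>1\<close> and \<open>x\<^sub>2\<close> enter as derivations of the function field. To
  have polynomial coefficients they are multiplied by \<open>p\<close>, which turns them into the vector fields
  \<open>p \<partial>\<^sub>1 - F\<^sub>1 \<partial>\<^sub>3\<close> and \<open>p \<partial>\<^sub>2 - F\<^sub>2 \<partial>\<^sub>3\<close> on 3-space, tangent to the surface.\<close>

section \<open>Polynomial functions\<close>

lemma polyfun_uminus:
  assumes "polyfun p"
  shows "polyfun (\<lambda>x. - p x)"
proof -
  have "polyfun (\<lambda>x. - 1 * p x)"
    by (intro polyfun.mult polyfun.const assms)
  then show ?thesis by simp
qed

lemma polyfun_diff:
  assumes "polyfun p" "polyfun q"
  shows "polyfun (\<lambda>x. p x - q x)"
proof -
  have "polyfun (\<lambda>x. p x + - q x)"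
    by (intro polyfun.add polyfun_uminus assms)
  then show ?thesis by simp
qed

lemma polyfun_power: "polyfun p \<Longrightarrow> polyfun (\<lambda>x. p x ^ n)"
  by (induction n) (simp_all add: polyfun.const polyfun.mult)

lemma polyfun_sum:
  assumes "\<And>i. i \<in> I \<Longrightarrow> polyfun (p i)"
  shows "polyfun (\<lambda>x. \<Sum>i\<in>I. p i x)"
  using assms
  by (induction I rule: infinite_finite_induct) (simp_all add: polyfun.const polyfun.add)

lemma polyfun_prod:
  assumes "\<And>i. i \<in> I \<Longrightarrow> polyfun (p i)"
  shows "polyfun (\<lambda>x. \<Prod>i\<in>I. p i x)"
  using assms
  by (induction I rule: infinite_finite_induct) (simp_all add: polyfun.const polyfun.mult)

lemmas polyfun_intros = polyfun.intros polyfun_uminus polyfun_diff polyfun_power polyfun_sum polyfun_prod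

lemma polyfun_on_line:
  assumes "polyfun p"
  shows "\<exists>P. \<forall>t. p (\<chi> i. u $ i + t * v $ i) = poly P t"
  using assms
proof induction
  case (const c)
  show ?case by (rule exI[of _ "[:c:]"]) simp
next
  case (coord i)
  show ?case by (rule exI[of _ "[:u $ i, v $ i:]"]) simp
next
  case (add p q)
  then obtain P Q where "\<forall>t. p (\<chi> i. u $ i + t * v $ i) = poly P t"
    "\<forall>t. q (\<chi> i. u $ i + t * v $ i) = poly Q t" by blast
  then show ?case by (intro exI[of _ "P + Q"]) simp
next
  case (mult p q)
  then obtain P Q where "\<forall>t. p (\<chi> i. u $ i + t * v $ i) = poly P t"
    "\<forall>t. q (\<chi> i. u $ i + t * v $ i) = poly Q t" by blast
  then show ?case by (intro exI[of _ "P * Q"]) simp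
qed

lemma finite_zeros_on_line:
  assumes "polyfun p" and "p (\<chi> i. u $ i + t0 * v $ i) \<noteq> 0"
  shows "finite {t. p (\<chi> i. u $ i + t * v $ i) = 0}"
proof -
  obtain P where P: "\<forall>t. p (\<chi> i. u $ i + t * v $ i) = poly P t"
    using polyfun_on_line[OF assms(1)] by blast
  with assms(2) have "P \<noteq> 0" by auto
  then show ?thesis using P poly_roots_finite[of P] by simp
qed

text \<open>Two points at which the respective factors do not vanish are joined by a complex line. Each factor
  has only finitely many zeros on it, so some point of the line is a zero of neither.\<close>

lemma polyfun_mult_eq_0:
  fixes p q :: "complex ^ 'n \<Rightarrow> complex"
  assumes "polyfun p" "polyfun q" and "\<And>x. p x * q x = 0"
  shows "(\<forall>x. p x = 0) \<or> (\<forall>x. q x = 0)"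
proof (rule ccontr)
  assume "\<not> ?thesis"
  then obtain u v where uv: "p u \<noteq> 0" "q v \<noteq> 0" by blast
  define l where "l t = (\<chi> i. u $ i + t * (v - u) $ i)" for t
  have "l 0 = u" "l 1 = v"
    by (simp_all add: l_def vec_eq_iff)
  then have "finite {t. p (l t) = 0}" "finite {t. q (l t) = 0}"
    using finite_zeros_on_line[OF assms(1), of u 0 "v - u"]
      finite_zeros_on_line[OF assms(2), of u 1 "v - u"] uv by (auto simp: l_def)
  then have "finite ({t. p (l t) = 0} \<union> {t. q (l t) = 0})"
    by simp
  moreover have "{t. p (l t) = 0} \<union> {t. q (l t) = 0} = UNIV"
    using assms(3) by auto
  ultimately show False
    using infinite_UNIV_char_0[where ?'a = complex] by simp
qed

text \<open>Substituting fractions into a polynomial gives a fraction whose denominator is a power of the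
  product of all denominators. This transports questions about rational parametrisations back to
  polynomials, to which \<open>polyfun_mult_eq_0\<close> applies.\<close>

lemma polyfun_clear_denominators:
  fixes p :: "complex ^ 'm \<Rightarrow> complex" and a b :: "'m \<Rightarrow> complex ^ 'n \<Rightarrow> complex"
  assumes "polyfun p" and a: "\<And>j. polyfun (a j)" and b: "\<And>j. polyfun (b j)"
  shows "\<exists>g N. polyfun g \<and> (\<forall>y. (\<Prod>j\<in>UNIV. b j y) \<noteq> 0 \<longrightarrow>
           g y = (\<Prod>j\<in>UNIV. b j y) ^ N * p (\<chi> j. a j y / b j y))"
  using assms(1)
proof induction
  case (const c)
  show ?case
    by (rule exI[of _ "\<lambda>y. c"], rule exI[of _ 0]) (simp add: polyfun.const)
next
  case (coord i)
  have "(\<Prod>j\<in>UNIV. b j y) = b i y * (\<Prod>j\<in>UNIV - {i}. b j y)" for y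
    by (subst prod.remove[of UNIV i]) auto
  then show ?case
    by (intro exI[of _ "\<lambda>y. a i y * (\<Prod>j\<in>UNIV - {i}. b j y)"] exI[of _ 1] conjI allI impI)
      (intro polyfun_intros a b, auto)
next
  case (add p q)
  then obtain g N h M where
    "polyfun g" "\<forall>y. (\<Prod>j\<in>UNIV. b j y) \<noteq> 0 \<longrightarrow> g y = (\<Prod>j\<in>UNIV. b j y) ^ N * p (\<chi> j. a j y / b j y)"
    "polyfun h" "\<forall>y. (\<Prod>j\<in>UNIV. b j y) \<noteq> 0 \<longrightarrow> h y = (\<Prod>j\<in>UNIV. b j y) ^ M * q (\<chi> j. a j y / b j y)"
    by blast
  then show ?case
    by (intro exI[of _ "\<lambda>y. (\<Prod>j\<in>UNIV. b j y) ^ M * g y + (\<Prod>j\<in>UNIV. b j y) ^ N * h y"] exI[of _ "N + M"] conjI)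
      (intro polyfun_intros a b, simp_all add: power_add algebra_simps)
next
  case (mult p q)
  then obtain g N h M where
    "polyfun g" "\<forall>y. (\<Prod>j\<in>UNIV. b j y) \<noteq> 0 \<longrightarrow> g y = (\<Prod>j\<in>UNIV. b j y) ^ N * p (\<chi> j. a j y / b j y)"
    "polyfun h" "\<forall>y. (\<Prod>j\<in>UNIV. b j y) \<noteq> 0 \<longrightarrow> h y = (\<Prod>j\<in>UNIV. b j y) ^ M * q (\<chi> j. a j y / b j y)"
    by blast
  then show ?case
    by (intro exI[of _ "\<lambda>y. g y * h y"] exI[of _ "N + M"] conjI)
      (intro polyfun_intros, simp_all add: power_add algebra_simps)
qed

text \<open>The gradient is characterised by the chain rule along all differentiable curves. This form passes
  through sums and products, and it yields the partial derivatives as soon as the curves are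
  coordinate lines.\<close>

definition has_gradient :: "(complex ^ 'n \<Rightarrow> complex) \<Rightarrow> ('n \<Rightarrow> complex ^ 'n \<Rightarrow> complex) \<Rightarrow> bool" where
  "has_gradient p g \<longleftrightarrow> (\<forall>\<gamma> \<gamma>' t.
     (\<forall>i. ((\<lambda>t. \<gamma> t $ i) has_field_derivative \<gamma>' i) (at t)) \<longrightarrow>
     ((\<lambda>t. p (\<gamma> t)) has_field_derivative (\<Sum>i\<in>UNIV. g i (\<gamma> t) * \<gamma>' i)) (at t))"

lemma has_gradientI:
  assumes "\<And>\<gamma> \<gamma>' t. (\<And>i. ((\<lambda>t. \<gamma> t $ i) has_field_derivative \<gamma>' i) (at t)) \<Longrightarrow>
     ((\<lambda>t. p (\<gamma> t)) has_field_derivative (\<Sum>i\<in>UNIV. g i (\<gamma> t) * \<gamma>' i)) (at t)"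
  shows "has_gradient p g"
  using assms by (simp add: has_gradient_def)

lemma has_gradientD:
  assumes "has_gradient p g" and "\<And>i. ((\<lambda>t. \<gamma> t $ i) has_field_derivative \<gamma>' i) (at t)"
  shows "((\<lambda>t. p (\<gamma> t)) has_field_derivative (\<Sum>i\<in>UNIV. g i (\<gamma> t) * \<gamma>' i)) (at t)"
  using assms by (simp add: has_gradient_def)

lemma polyfun_gradient_exists:
  fixes p :: "complex ^ 'n \<Rightarrow> complex"
  assumes "polyfun p"
  shows "\<exists>g. (\<forall>i. polyfun (g i)) \<and> has_gradient p g"
  using assms
proof induction
  case (const c)
  have "has_gradient (\<lambda>x :: complex ^ 'n. c) (\<lambda>i x. 0)"
    by (rule has_gradientI) simp
  then show ?case
    by (intro exI[of _ "\<lambda>i x. 0"] conjI allI polyfun.const)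
next
  case (coord k)
  have "has_gradient (\<lambda>x :: complex ^ 'n. x $ k) (\<lambda>i x. if i = k then 1 else 0)"
    by (rule has_gradientI) (simp add: if_distrib[of "\<lambda>u. u * _"] cong: if_cong)
  then show ?case
    by (intro exI[of _ "\<lambda>i x. if i = k then 1 else 0"] conjI allI polyfun.const)
next
  case (add p q)
  then obtain g h where g: "\<And>i. polyfun (g i)" "\<And>i. polyfun (h i)"
    and d: "has_gradient p g" "has_gradient q h"
    by blast
  have "has_gradient (\<lambda>x. p x + q x) (\<lambda>i x. g i x + h i x)"
    by (rule has_gradientI, rule DERIV_cong[OF DERIV_add[OF has_gradientD[OF d(1)] has_gradientD[OF d(2)]]])
      (simp_all add: distrib_right sum.distrib)
  then show ?case
    by (intro exI[of _ "\<lambda>i x. g i x + h i x"] conjI allI polyfun.add g)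
next
  case (mult p q)
  then obtain g h where g: "\<And>i. polyfun (g i)" "\<And>i. polyfun (h i)"
    and d: "has_gradient p g" "has_gradient q h"
    by blast
  have "has_gradient (\<lambda>x. p x * q x) (\<lambda>i x. g i x * q x + p x * h i x)"
    by (rule has_gradientI, rule DERIV_cong[OF DERIV_mult[OF has_gradientD[OF d(1)] has_gradientD[OF d(2)]]])
      (assumption | simp only: sum_distrib_left sum_distrib_right sum.distrib[symmetric],
        rule sum.cong; simp add: algebra_simps)+
  then show ?case
    by (intro exI[of _ "\<lambda>i x. g i x * q x + p x * h i x"] conjI allI polyfun.add polyfun.mult g mult.hyps)
qed

lemma has_derivative_coordinate_line:
  "((\<lambda>t. (\<chi> j. if j = i then t else x $ j) $ k) has_field_derivative (if k = i then 1 else 0)) (at (t::complex))"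
  by (cases "k = i") simp_all

lemma partial_deriv_eq_gradient:
  assumes "has_gradient p g"
  shows "partial_deriv i p = g i"
proof
  fix x :: "complex ^ _"
  let ?\<gamma> = "\<lambda>t. \<chi> j. if j = i then t else x $ j"
  have "((\<lambda>t. p (?\<gamma> t)) has_field_derivative
      (\<Sum>j\<in>UNIV. g j (?\<gamma> (x $ i)) * (if j = i then 1 else 0))) (at (x $ i))"
    by (rule has_gradientD[OF assms]) (rule has_derivative_coordinate_line)
  moreover have "?\<gamma> (x $ i) = x"
    by (simp add: vec_eq_iff)
  ultimately show "partial_deriv i p x = g i x"
    unfolding partial_deriv_def
    by (simp add: DERIV_imp_deriv if_distrib[of "\<lambda>u. _ * u"] cong: if_cong)
qed

lemma
  assumes "polyfun p"
  shows polyfun_partial_deriv: "polyfun (partial_deriv i p)"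
    and polyfun_has_gradient: "has_gradient p (\<lambda>i. partial_deriv i p)"
proof -
  obtain g where g: "\<And>i. polyfun (g i)" "has_gradient p g"
    using polyfun_gradient_exists[OF assms] by blast
  then have *: "(\<lambda>i. partial_deriv i p) = g"
    using partial_deriv_eq_gradient[OF g(2)] by blast
  show "polyfun (partial_deriv i p)"
    using g(1) partial_deriv_eq_gradient[OF g(2)] by simp
  show "has_gradient p (\<lambda>i. partial_deriv i p)"
    unfolding * by (rule g)
qed

lemmas polyfun_chain_rule = has_gradientD[OF polyfun_has_gradient]

lemma polyfun_has_partial_deriv:
  assumes "polyfun p"
  shows "((\<lambda>t. p (\<chi> j. if j = i then t else x $ j)) has_field_derivative partial_deriv i p x) (at (x $ i))"
proof -
  let ?\<gamma> = "\<lambda>t. \<chi> j. if j = i then t else x $ j"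
  have "((\<lambda>t. p (?\<gamma> t)) has_field_derivative
      (\<Sum>j\<in>UNIV. partial_deriv j p (?\<gamma> (x $ i)) * (if j = i then 1 else 0))) (at (x $ i))"
    by (rule polyfun_chain_rule[OF assms]) (rule has_derivative_coordinate_line)
  moreover have "?\<gamma> (x $ i) = x"
    by (simp add: vec_eq_iff)
  ultimately show ?thesis
    by (simp add: if_distrib[of "\<lambda>u. _ * u"] cong: if_cong)
qed

lemma partial_deriv_const: "partial_deriv i (\<lambda>x. c) x = 0"
  by (simp add: partial_deriv_def)

lemma partial_deriv_coord: "partial_deriv i (\<lambda>x. x $ k) x = (if i = k then 1 else 0)"
  unfolding partial_deriv_def
  by (rule DERIV_imp_deriv[OF has_derivative_coordinate_line, THEN trans]) (simp add: eq_commute)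

lemma partial_deriv_add:
  assumes "polyfun p" "polyfun q"
  shows "partial_deriv i (\<lambda>x. p x + q x) x = partial_deriv i p x + partial_deriv i q x"
  unfolding partial_deriv_def[of i "\<lambda>x. p x + q x"]
  by (rule DERIV_imp_deriv[OF DERIV_add[OF polyfun_has_partial_deriv[OF assms(1)] polyfun_has_partial_deriv[OF assms(2)]]])

lemma partial_deriv_mult:
  assumes "polyfun p" "polyfun q"
  shows "partial_deriv i (\<lambda>x. p x * q x) x = partial_deriv i p x * q x + partial_deriv i q x * p x"
proof -
  have *: "(\<chi> j. if j = i then x $ i else x $ j) = x"
    by (simp add: vec_eq_iff)
  show ?thesis
    unfolding partial_deriv_def[of i "\<lambda>x. p x * q x"]
    by (rule DERIV_imp_deriv[OF DERIV_mult[OF polyfun_has_partial_deriv[OF assms(1), of i x]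
          polyfun_has_partial_deriv[OF assms(2), of i x], unfolded *]])
qed

section \<open>The function field of an irreducible set\<close>

text \<open>The condition is that the polynomials vanishing on \<open>X\<close> form a prime ideal.\<close>

locale irreducible_set =
  fixes X :: "(complex ^ 'n) set"
  assumes nonempty: "X \<noteq> {}"
    and prime: "\<lbrakk>polyfun p; polyfun q; \<And>x. x \<in> X \<Longrightarrow> p x * q x = 0\<rbrakk> \<Longrightarrow>
      (\<forall>x\<in>X. p x = 0) \<or> (\<forall>x\<in>X. q x = 0)"

lemma irreducible_set_UNIV: "irreducible_set (UNIV :: (complex ^ 'n) set)"
  by unfold_locales (use polyfun_mult_eq_0 in auto)

lemma fractions_iff: "(a, b) \<in> fractions X \<longleftrightarrow> polyfun a \<and> polyfun b \<and> (\<exists>x\<in>X. b x \<noteq> 0)"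
  by (simp add: fractions_def)

lemma frac_class_iff:
  "(c, d) \<in> frac_class X a b \<longleftrightarrow> (c, d) \<in> fractions X \<and> (\<forall>x\<in>X. a x * d x = c x * b x)"
  by (simp add: frac_class_def)

lemma frac_class_refl: "(a, b) \<in> fractions X \<Longrightarrow> (a, b) \<in> frac_class X a b"
  by (simp add: frac_class_iff)

lemma frac_class_closed: "(a, b) \<in> fractions X \<Longrightarrow> frac_class X a b \<in> carrier (function_field X)"
  by (auto simp: function_field_def)

lemma function_field_cases:
  assumes "f \<in> carrier (function_field X)"
  obtains a b where "(a, b) \<in> fractions X" "f = frac_class X a b"
  using assms by (auto simp: function_field_def)

context irreducible_set
begin

abbreviation "K \<equiv> function_field X"
abbreviation "fraction \<equiv> frac_class X"

lemma fractions_one: "polyfun a \<Longrightarrow> (a, \<lambda>x. 1) \<in> fractions X"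
  using nonempty by (auto simp: fractions_iff polyfun.const)

lemma nonzero_mult:
  assumes "(a, b) \<in> fractions X" "(c, d) \<in> fractions X"
  shows "\<exists>x\<in>X. b x * d x \<noteq> 0"
  using prime[of b d] assms unfolding fractions_iff by blast

lemma cancel_denominator:
  assumes "polyfun p" "(a, b) \<in> fractions X" and "\<And>x. x \<in> X \<Longrightarrow> p x * b x = 0"
  shows "\<forall>x\<in>X. p x = 0"
  using prime[of p b] assms unfolding fractions_iff by blast

lemma fractions_denominator:
  assumes "(a, b) \<in> fractions X" "(c, d) \<in> fractions X" "polyfun p"
  shows "(p, \<lambda>x. b x * d x) \<in> fractions X"
  using nonzero_mult[OF assms(1,2)] assms unfolding fractions_iff by (blast intro: polyfun.mult)

lemma fractions_mult:
  assumes "(a, b) \<in> fractions X" "(c, d) \<in> fractions X"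
  shows "(\<lambda>x. a x * c x, \<lambda>x. b x * d x) \<in> fractions X"
  by (rule fractions_denominator[OF assms]) (use assms in \<open>simp add: fractions_iff polyfun.mult\<close>)

lemma fractions_add:
  assumes "(a, b) \<in> fractions X" "(c, d) \<in> fractions X"
  shows "(\<lambda>x. a x * d x + c x * b x, \<lambda>x. b x * d x) \<in> fractions X"
  by (rule fractions_denominator[OF assms]) (use assms in \<open>simp add: fractions_iff polyfun.mult polyfun.add\<close>)

text \<open>Transitivity of cross-multiplication: it requires the denominator \<open>b'\<close> to be cancelled, hence
  irreducibility.\<close>

lemma frac_trans:
  assumes ab: "(a, b) \<in> fraction a' b'" "(a', b') \<in> fractions X"
    and cd: "(c, d) \<in> fraction a' b'"
  shows "(c, d) \<in> fraction a b"
proof -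
  have F: "polyfun (\<lambda>x. a x * d x - c x * b x)"
    using ab cd by (intro polyfun_diff polyfun.mult) (simp_all add: frac_class_iff fractions_iff)
  have "(a x * d x - c x * b x) * b' x = 0" if "x \<in> X" for x
  proof -
    have "a' x * b x = a x * b' x" "a' x * d x = c x * b' x"
      using ab cd that by (auto simp: frac_class_iff)
    then have "(a x * b' x) * d x - (c x * b' x) * b x = (a' x * b x) * d x - (a' x * d x) * b x"
      by simp
    then show ?thesis by (simp add: algebra_simps)
  qed
  from cancel_denominator[OF F ab(2) this] cd show ?thesis
    by (simp add: frac_class_iff)
qed

lemma frac_eq_iff:
  assumes "(a, b) \<in> fractions X" "(c, d) \<in> fractions X"
  shows "fraction a b = fraction c d \<longleftrightarrow> (\<forall>x\<in>X. a x * d x = c x * b x)"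
proof
  assume "fraction a b = fraction c d"
  with frac_class_refl[OF assms(2)] have "(c, d) \<in> fraction a b"
    by simp
  then show "\<forall>x\<in>X. a x * d x = c x * b x"
    by (simp add: frac_class_iff)
next
  assume eq: "\<forall>x\<in>X. a x * d x = c x * b x"
  then have *: "(c, d) \<in> fraction a b" "(a, b) \<in> fraction c d"
    using assms by (simp_all add: frac_class_iff)
  show "fraction a b = fraction c d"
  proof (intro equalityI subsetI)
    show "p \<in> fraction c d" if "p \<in> fraction a b" for p
      using frac_trans[OF *(1) assms(1), of "fst p" "snd p"] that by simp
    show "p \<in> fraction a b" if "p \<in> fraction c d" for p
      using frac_trans[OF *(2) assms(2), of "fst p" "snd p"] that by simp
  qed
qed

lemma frac_cong:
  assumes "(a, b) \<in> fractions X" "(c, d) \<in> fraction a b"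
  shows "fraction c d = fraction a b"
  using frac_eq_iff[of c d a b] assms by (auto simp: frac_class_iff)

text \<open>The operations of the function field are unions over all pairs of representatives. They can be
  computed from one pair because all members of the union coincide.\<close>

lemma UN_pair_const:
  assumes "p \<in> S" "q \<in> T" and f: "\<And>a b c d. (a, b) \<in> S \<Longrightarrow> (c, d) \<in> T \<Longrightarrow> f a b c d = Z"
  shows "(\<Union>(a, b)\<in>S. \<Union>(c, d)\<in>T. f a b c d) = Z"
proof -
  have "(\<Union>(c, d)\<in>T. f a b c d) = (\<Union>q\<in>T. Z)" if "(a, b) \<in> S" for a b
    by (rule SUP_cong) (use f[OF that] in auto)
  also have "(\<Union>q\<in>T. Z) = Z"
    using \<open>q \<in> T\<close> by auto
  finally have *: "(\<Union>(c, d)\<in>T. f a b c d) = Z" if "(a, b) \<in> S" for a b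
    using that .
  have "(\<Union>(a, b)\<in>S. \<Union>(c, d)\<in>T. f a b c d) = (\<Union>p\<in>S. Z)"
    by (rule SUP_cong[OF refl]) (use * in \<open>simp add: split_beta\<close>)
  also have "\<dots> = Z"
    using \<open>p \<in> S\<close> by auto
  finally show ?thesis .
qed

lemma mult_frac:
  assumes "(a, b) \<in> fractions X" "(c, d) \<in> fractions X"
  shows "fraction a b \<otimes>\<^bsub>K\<^esub> fraction c d = fraction (\<lambda>x. a x * c x) (\<lambda>x. b x * d x)"
proof -
  have *: "fraction (\<lambda>x. a' x * c' x) (\<lambda>x. b' x * d' x) = fraction (\<lambda>x. a x * c x) (\<lambda>x. b x * d x)"
    if "(a', b') \<in> fraction a b" "(c', d') \<in> fraction c d" for a' b' c' d'
  proof (subst frac_eq_iff)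
    show "(\<lambda>x. a' x * c' x, \<lambda>x. b' x * d' x) \<in> fractions X" "(\<lambda>x. a x * c x, \<lambda>x. b x * d x) \<in> fractions X"
      using that assms by (auto intro!: fractions_mult simp: frac_class_iff)
    show "\<forall>x\<in>X. a' x * c' x * (b x * d x) = a x * c x * (b' x * d' x)"
    proof
      fix x assume "x \<in> X"
      then have "a x * b' x = a' x * b x" "c x * d' x = c' x * d x"
        using that by (auto simp: frac_class_iff)
      moreover have "a' x * c' x * (b x * d x) = (a' x * b x) * (c' x * d x)"
        by simp
      ultimately show "a' x * c' x * (b x * d x) = a x * c x * (b' x * d' x)"
        by (simp add: mult_ac)
    qed
  qed
  show ?thesis
    unfolding function_field_def ring_record_simps
    by (rule UN_pair_const[OF frac_class_refl[OF assms(1)] frac_class_refl[OF assms(2)] *])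
qed

lemma add_frac:
  assumes "(a, b) \<in> fractions X" "(c, d) \<in> fractions X"
  shows "fraction a b \<oplus>\<^bsub>K\<^esub> fraction c d = fraction (\<lambda>x. a x * d x + c x * b x) (\<lambda>x. b x * d x)"
proof -
  have *: "fraction (\<lambda>x. a' x * d' x + c' x * b' x) (\<lambda>x. b' x * d' x) = fraction (\<lambda>x. a x * d x + c x * b x) (\<lambda>x. b x * d x)"
    if "(a', b') \<in> fraction a b" "(c', d') \<in> fraction c d" for a' b' c' d'
  proof (subst frac_eq_iff)
    show "(\<lambda>x. a' x * d' x + c' x * b' x, \<lambda>x. b' x * d' x) \<in> fractions X"
      "(\<lambda>x. a x * d x + c x * b x, \<lambda>x. b x * d x) \<in> fractions X"
      using that assms by (auto intro!: fractions_add simp: frac_class_iff)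
    show "\<forall>x\<in>X. (a' x * d' x + c' x * b' x) * (b x * d x) = (a x * d x + c x * b x) * (b' x * d' x)"
    proof
      fix x assume "x \<in> X"
      then have "a x * b' x = a' x * b x" "c x * d' x = c' x * d x"
        using that by (auto simp: frac_class_iff)
      moreover have "(a' x * d' x + c' x * b' x) * (b x * d x) =
          (a' x * b x) * (d x * d' x) + (c' x * d x) * (b x * b' x)"
        by (simp add: algebra_simps)
      ultimately show "(a' x * d' x + c' x * b' x) * (b x * d x) = (a x * d x + c x * b x) * (b' x * d' x)"
        by (simp add: algebra_simps)
    qed
  qed
  show ?thesis
    unfolding function_field_def ring_record_simps
    by (rule UN_pair_const[OF frac_class_refl[OF assms(1)] frac_class_refl[OF assms(2)] *])
qed

lemma zero_frac: "\<zero>\<^bsub>K\<^esub> = fraction (\<lambda>x. 0) (\<lambda>x. 1)"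
  by (simp add: function_field_def)

lemma one_frac: "\<one>\<^bsub>K\<^esub> = fraction (\<lambda>x. 1) (\<lambda>x. 1)"
  by (simp add: function_field_def)

lemma frac_eq_zero_iff:
  assumes "(a, b) \<in> fractions X"
  shows "fraction a b = \<zero>\<^bsub>K\<^esub> \<longleftrightarrow> (\<forall>x\<in>X. a x = 0)"
  unfolding zero_frac using frac_eq_iff[OF assms fractions_one[OF polyfun.const]] by simp

lemma fractions_swap:
  assumes "(a, b) \<in> fractions X" "fraction a b \<noteq> \<zero>\<^bsub>K\<^esub>"
  shows "(b, a) \<in> fractions X"
  using assms frac_eq_zero_iff[OF assms(1)] by (auto simp: fractions_iff)

lemma fractions_uminus: "(a, b) \<in> fractions X \<Longrightarrow> (\<lambda>x. - a x, b) \<in> fractions X"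
  by (simp add: fractions_iff polyfun_uminus)

lemma fraction_add_uminus:
  assumes "(a, b) \<in> fractions X"
  shows "fraction (\<lambda>x. - a x) b \<oplus>\<^bsub>K\<^esub> fraction a b = \<zero>\<^bsub>K\<^esub>"
  unfolding add_frac[OF fractions_uminus[OF assms] assms]
  by (subst frac_eq_zero_iff, rule fractions_add[OF fractions_uminus[OF assms] assms]) simp

lemma fraction_mult_swap:
  assumes "(a, b) \<in> fractions X" "(b, a) \<in> fractions X"
  shows "fraction a b \<otimes>\<^bsub>K\<^esub> fraction b a = \<one>\<^bsub>K\<^esub>"
  unfolding mult_frac[OF assms] one_frac
  by (subst frac_eq_iff, rule fractions_mult[OF assms], rule fractions_one[OF polyfun.const]) simp

lemmas frac_calc = fractions_mult fractions_add fractions_one polyfun.const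

lemma cring_function_field: "cring K"
proof (intro cringI abelian_groupI comm_monoidI; (elim function_field_cases; hypsubst)?)
  show "\<zero>\<^bsub>K\<^esub> \<in> carrier K" "\<one>\<^bsub>K\<^esub> \<in> carrier K"
    unfolding zero_frac one_frac by (intro frac_class_closed fractions_one polyfun.const)+
next
  fix a b assume ab: "(a, b) \<in> fractions X"
  show "\<zero>\<^bsub>K\<^esub> \<oplus>\<^bsub>K\<^esub> fraction a b = fraction a b" "\<one>\<^bsub>K\<^esub> \<otimes>\<^bsub>K\<^esub> fraction a b = fraction a b"
    unfolding zero_frac one_frac
    by (simp_all add: add_frac mult_frac frac_calc ab)
  show "\<exists>g\<in>carrier K. g \<oplus>\<^bsub>K\<^esub> fraction a b = \<zero>\<^bsub>K\<^esub>"
    using fraction_add_uminus[OF ab] frac_class_closed[OF fractions_uminus[OF ab]] by blast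
next
  fix a b c d assume ab: "(a, b) \<in> fractions X" and cd: "(c, d) \<in> fractions X"
  show "fraction a b \<oplus>\<^bsub>K\<^esub> fraction c d \<in> carrier K" "fraction a b \<otimes>\<^bsub>K\<^esub> fraction c d \<in> carrier K"
    by (simp_all add: add_frac mult_frac ab cd frac_calc frac_class_closed)
  show "fraction a b \<oplus>\<^bsub>K\<^esub> fraction c d = fraction c d \<oplus>\<^bsub>K\<^esub> fraction a b"
    "fraction a b \<otimes>\<^bsub>K\<^esub> fraction c d = fraction c d \<otimes>\<^bsub>K\<^esub> fraction a b"
    by (simp_all add: add_frac mult_frac ab cd algebra_simps)
next
  fix a b c d e f
  assume ab: "(a, b) \<in> fractions X" and cd: "(c, d) \<in> fractions X" and ef: "(e, f) \<in> fractions X"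
  show "fraction a b \<oplus>\<^bsub>K\<^esub> fraction c d \<oplus>\<^bsub>K\<^esub> fraction e f = fraction a b \<oplus>\<^bsub>K\<^esub> (fraction c d \<oplus>\<^bsub>K\<^esub> fraction e f)"
    "fraction a b \<otimes>\<^bsub>K\<^esub> fraction c d \<otimes>\<^bsub>K\<^esub> fraction e f = fraction a b \<otimes>\<^bsub>K\<^esub> (fraction c d \<otimes>\<^bsub>K\<^esub> fraction e f)"
    "(fraction a b \<oplus>\<^bsub>K\<^esub> fraction c d) \<otimes>\<^bsub>K\<^esub> fraction e f = fraction a b \<otimes>\<^bsub>K\<^esub> fraction e f \<oplus>\<^bsub>K\<^esub> fraction c d \<otimes>\<^bsub>K\<^esub> fraction e f"
    by (simp_all add: add_frac mult_frac ab cd ef frac_calc frac_eq_iff) (simp_all add: algebra_simps)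
qed

lemma field_function_field: "field K"
proof (rule cring.cring_fieldI2[OF cring_function_field])
  show "\<zero>\<^bsub>K\<^esub> \<noteq> \<one>\<^bsub>K\<^esub>"
    using nonempty unfolding zero_frac one_frac by (auto simp: frac_eq_iff frac_calc)
next
  fix f assume "f \<in> carrier K" "f \<noteq> \<zero>\<^bsub>K\<^esub>"
  then obtain a b where ab: "(a, b) \<in> fractions X" "f = fraction a b" "(b, a) \<in> fractions X"
    by (metis function_field_cases fractions_swap)
  then show "\<exists>g\<in>carrier K. f \<otimes>\<^bsub>K\<^esub> g = \<one>\<^bsub>K\<^esub>"
    using fraction_mult_swap[OF ab(1,3)] frac_class_closed[OF ab(3)] by blast
qed

sublocale K: field K
  by (rule field_function_field)

lemma uminus_frac:
  assumes "(a, b) \<in> fractions X"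
  shows "\<ominus>\<^bsub>K\<^esub> fraction a b = fraction (\<lambda>x. - a x) b"
  using K.minus_equality[OF fraction_add_uminus[OF assms]] assms
  by (simp add: frac_class_closed fractions_uminus)

lemma minus_frac:
  assumes "(a, b) \<in> fractions X" "(c, d) \<in> fractions X"
  shows "fraction a b \<ominus>\<^bsub>K\<^esub> fraction c d = fraction (\<lambda>x. a x * d x - c x * b x) (\<lambda>x. b x * d x)"
  unfolding a_minus_def by (simp add: uminus_frac add_frac assms fractions_uminus)

end

section \<open>Rational and birational maps\<close>

lemma rat_val_frac:
  assumes "(a, b) \<in> fractions X" "x \<in> X" "b x \<noteq> 0"
  shows "rat_val (frac_class X a b) x = a x / b x"
  unfolding rat_val_def
proof (rule the_equality)
  show "\<exists>(a', b')\<in>frac_class X a b. b' x \<noteq> 0 \<and> a x / b x = a' x / b' x"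
    using frac_class_refl[OF assms(1)] assms(3) by blast
  show "w = a x / b x" if "\<exists>(c, d)\<in>frac_class X a b. d x \<noteq> 0 \<and> w = c x / d x" for w
    using that assms(2,3) by (auto simp: frac_class_iff frac_eq_eq)
qed

lemma rat_dom_frac:
  assumes "(a, b) \<in> fractions X" "x \<in> X" "b x \<noteq> 0"
  shows "x \<in> rat_dom X (frac_class X a b)"
  using frac_class_refl[OF assms(1)] assms(2,3) unfolding rat_dom_def by blast

text \<open>A point of the domain of definition may need its own representative: the denominator of a given one
  can vanish there.\<close>

lemma (in irreducible_set) rat_dom_cases:
  assumes "f \<in> carrier K" "x \<in> rat_dom X f"
  obtains a b where "(a, b) \<in> fractions X" "b x \<noteq> 0" "f = fraction a b"
proof -
  obtain a b where ab: "(a, b) \<in> fractions X" "f = fraction a b"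
    using function_field_cases[OF assms(1)] .
  obtain c d where cd: "(c, d) \<in> f" "d x \<noteq> 0"
    using assms(2) by (auto simp: rat_dom_def)
  have "(c, d) \<in> fractions X" "fraction c d = f"
    using cd(1) frac_cong[OF ab(1)] by (simp_all add: ab(2) frac_class_iff)
  with cd(2) show thesis
    using that by blast
qed

lemma zariski_openin_nonzero: "polyfun k \<Longrightarrow> zariski_openin X {x \<in> X. k x \<noteq> 0}"
  unfolding zariski_openin_def by (rule exI[of _ "{k}"]) simp

lemma zariski_openin_UNIV_cases:
  assumes "zariski_openin UNIV U" "U \<noteq> {}"
  obtains p where "polyfun p" "\<And>x. p x \<noteq> 0 \<Longrightarrow> x \<in> U" "\<exists>x. p x \<noteq> 0"
  using assms unfolding zariski_openin_def by blast

text \<open>A birational map to affine space is dominant: were a component zero, the image of the inverse map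
  would force a coordinate function to vanish on a nonempty open set of affine space.\<close>

lemma birational_map_component_nonzero:
  assumes "birational_map X UNIV \<phi>"
  shows "\<phi> i \<noteq> \<zero>\<^bsub>function_field X\<^esub>"
proof
  assume zero: "\<phi> i = \<zero>\<^bsub>function_field X\<^esub>"
  obtain \<psi> U where U: "zariski_openin UNIV U" "U \<noteq> {}"
    and id: "\<And>y. y \<in> U \<Longrightarrow> ratmap_val \<psi> y \<in> ratmap_dom X \<phi> \<and> ratmap_val \<phi> (ratmap_val \<psi> y) = y"
    using assms unfolding birational_map_def ratmap_comp_id_def by blast
  obtain p where p: "polyfun p" "\<And>x. p x \<noteq> 0 \<Longrightarrow> x \<in> U" "\<exists>x. p x \<noteq> 0"
    using zariski_openin_UNIV_cases[OF U] by blast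
  have "y $ i = 0" if "p y \<noteq> 0" for y
  proof -
    let ?x = "ratmap_val \<psi> y"
    have x: "?x \<in> X" "ratmap_val \<phi> ?x $ i = y $ i"
      using id[OF p(2)[OF that]] by (simp_all add: ratmap_dom_def)
    then have "(\<lambda>x. 0, \<lambda>x. 1) \<in> fractions X"
      by (auto simp: fractions_iff polyfun.const)
    then have "rat_val \<zero>\<^bsub>function_field X\<^esub> ?x = 0"
      using rat_val_frac[OF _ x(1), of "\<lambda>x. 0" "\<lambda>x. 1"] by (simp add: function_field_def)
    with x(2) zero show ?thesis
      by (simp add: ratmap_val_def)
  qed
  then have "p y * y $ i = 0" for y
    by auto
  from polyfun_mult_eq_0[OF p(1) polyfun.coord this] p(3) have "\<forall>y :: complex ^ 'b. y $ i = 0"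
    by blast
  from this[rule_format, of "\<chi> j. 1"] show False by simp
qed

text \<open>Two mutually inverse fractional formulas define a birational map, the polynomials \<open>k\<close> and \<open>h\<close> cutting out
  the open sets on which they may be evaluated. The claim that is not immediate is that the inverse
  takes values in \<open>X\<close> on its whole domain of definition, whereas the formula is controlled only where \<open>h\<close>
  does not vanish; this holds because \<open>X\<close> is closed.\<close>

lemma birational_map_affineI:
  fixes F :: "complex ^ 'n \<Rightarrow> complex" and a b :: "'m::finite \<Rightarrow> complex ^ 'n \<Rightarrow> complex"
    and c d :: "'n \<Rightarrow> complex ^ 'm \<Rightarrow> complex"
  defines "X \<equiv> {x. F x = 0}"
    and "f \<equiv> \<lambda>x. \<chi> i. a i x / b i x" and "g \<equiv> \<lambda>y. \<chi> j. c j y / d j y"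
  assumes F: "polyfun F" and ab: "\<And>i. (a i, b i) \<in> fractions X"
    and cd: "\<And>j. polyfun (c j)" "\<And>j. polyfun (d j)"
    and k: "polyfun k" "\<exists>x\<in>X. k x \<noteq> 0"
    and h: "polyfun h" "\<exists>y. h y \<noteq> 0"
    and gf: "\<And>x. x \<in> X \<Longrightarrow> k x \<noteq> 0 \<Longrightarrow> (\<forall>i. b i x \<noteq> 0) \<and> (\<forall>j. d j (f x) \<noteq> 0) \<and> g (f x) = x"
    and fg: "\<And>y. h y \<noteq> 0 \<Longrightarrow> (\<forall>j. d j y \<noteq> 0) \<and> g y \<in> X \<and> (\<forall>i. b i (g y) \<noteq> 0) \<and> f (g y) = y"
  shows "birational_map X UNIV (\<lambda>i. frac_class X (a i) (b i))"
proof -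
  interpret Y: irreducible_set "UNIV :: (complex ^ 'm) set"
    by (rule irreducible_set_UNIV)
  define \<phi> where "\<phi> = (\<lambda>i. frac_class X (a i) (b i))"
  define \<psi> where "\<psi> = (\<lambda>j. frac_class UNIV (c j) (d j))"
  have cd': "(c j, d j) \<in> fractions UNIV" for j
    using cd h(2) fg unfolding fractions_iff by blast
  have dom_\<phi>: "x \<in> ratmap_dom X \<phi> \<and> ratmap_val \<phi> x = f x" if "x \<in> X" "\<forall>i. b i x \<noteq> 0" for x
    using that rat_dom_frac[OF ab] rat_val_frac[OF ab]
    by (simp add: ratmap_dom_def ratmap_val_def \<phi>_def f_def)
  have dom_\<psi>: "y \<in> ratmap_dom UNIV \<psi> \<and> ratmap_val \<psi> y = g y" if "\<forall>j. d j y \<noteq> 0" for y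
    using that rat_dom_frac[OF cd'] rat_val_frac[OF cd']
    by (simp add: ratmap_dom_def ratmap_val_def \<psi>_def g_def)
  have "rational_map X UNIV \<phi>"
    using frac_class_closed[OF ab] by (simp add: rational_map_def \<phi>_def)
  moreover have "rational_map UNIV X \<psi>"
    unfolding rational_map_def
  proof (intro conjI allI ballI)
    show "\<psi> j \<in> carrier (function_field UNIV)" for j
      using frac_class_closed[OF cd'] by (simp add: \<psi>_def)
    fix y assume y: "y \<in> ratmap_dom UNIV \<psi>"
    have "\<exists>p q. (p, q) \<in> fractions UNIV \<and> q y \<noteq> 0 \<and> \<psi> j = frac_class UNIV p q" for j
    proof -
      have "y \<in> rat_dom UNIV (frac_class UNIV (c j) (d j))"
        using y by (simp add: ratmap_dom_def \<psi>_def)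
      from Y.rat_dom_cases[OF frac_class_closed[OF cd'] this] show ?thesis
        unfolding \<psi>_def by metis
    qed
    then obtain p q where pq: "\<And>j. (p j, q j) \<in> fractions UNIV" "\<And>j. q j y \<noteq> 0"
      "\<And>j. \<psi> j = frac_class UNIV (p j) (q j)"
      by metis
    have polys: "polyfun (p j)" "polyfun (q j)" for j
      using pq(1) by (auto simp: fractions_iff)
    \<comment> \<open>Pulling back \<open>F\<close> along the representatives that are regular at \<open>y\<close> gives a polynomial
      \<open>G\<close>, which vanishes on the dense set where \<open>h\<close> and \<open>Q\<close> do not, hence at \<open>y\<close>.\<close>
    define Q where "Q = (\<lambda>y. \<Prod>j\<in>UNIV. q j y)"
    obtain G N where G: "polyfun G" "\<And>y. Q y \<noteq> 0 \<Longrightarrow> G y = Q y ^ N * F (\<chi> j. p j y / q j y)"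
      using polyfun_clear_denominators[OF F, of p q, OF polys] unfolding Q_def by blast
    have Q: "polyfun Q"
      unfolding Q_def by (intro polyfun_prod polys)
    have Qy: "Q y \<noteq> 0"
      using pq(2) by (simp add: Q_def)
    have "G z * (h z * Q z) = 0" for z
    proof (cases "h z * Q z = 0")
      case False
      then have nz: "\<forall>j. d j z \<noteq> 0" "\<And>j. q j z \<noteq> 0" "g z \<in> X"
        using fg[of z] by (auto simp: Q_def)
      have "p j z / q j z = c j z / d j z" for j
        using Y.frac_eq_iff[OF pq(1)[of j] cd'[of j]] pq(3)[of j] nz
        by (simp add: \<psi>_def frac_eq_eq)
      then have "F (\<chi> j. p j z / q j z) = 0"
        using nz(3) by (simp add: g_def X_def)
      then show ?thesis
        using G(2) False by simp
    qed simp
    then have "(\<forall>z. G z = 0) \<or> (\<forall>z. h z * Q z = 0)"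
      by (rule polyfun_mult_eq_0[OF G(1) polyfun.mult[OF h(1) Q]])
    moreover have "\<not> (\<forall>z. h z * Q z = 0)"
      using polyfun_mult_eq_0[OF h(1) Q] h(2) Qy by blast
    ultimately have "G y = 0"
      by blast
    then have "F (\<chi> j. p j y / q j y) = 0"
      using G(2)[OF Qy] Qy by simp
    moreover have "ratmap_val \<psi> y = (\<chi> j. p j y / q j y)"
      unfolding ratmap_val_def pq(3) using rat_val_frac[OF pq(1)] pq(2) by simp
    ultimately show "ratmap_val \<psi> y \<in> X"
      by (simp add: X_def)
  qed
  moreover have "ratmap_comp_id X UNIV \<phi> \<psi>"
    unfolding ratmap_comp_id_def
  proof (intro exI conjI ballI)
    show "zariski_openin X {x \<in> X. k x \<noteq> 0}"
      using k(1) by (rule zariski_openin_nonzero)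
    show "{x \<in> X. k x \<noteq> 0} \<noteq> {}"
      using k(2) by blast
    fix x assume "x \<in> {x \<in> X. k x \<noteq> 0}"
    then have x: "x \<in> X" "k x \<noteq> 0" by auto
    show "x \<in> ratmap_dom X \<phi>" "ratmap_val \<phi> x \<in> ratmap_dom UNIV \<psi>"
      "ratmap_val \<psi> (ratmap_val \<phi> x) = x"
      using gf[OF x] dom_\<phi>[OF x(1)] dom_\<psi>[of "f x"] by simp_all
  qed
  moreover have "ratmap_comp_id UNIV X \<psi> \<phi>"
    unfolding ratmap_comp_id_def
  proof (intro exI conjI ballI)
    show "zariski_openin UNIV {y \<in> UNIV. h y \<noteq> 0}"
      using h(1) by (rule zariski_openin_nonzero)
    show "{y \<in> UNIV. h y \<noteq> 0} \<noteq> {}"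
      using h(2) by blast
    fix y assume "y \<in> {y \<in> UNIV. h y \<noteq> 0}"
    then have y: "h y \<noteq> 0" by simp
    show "y \<in> ratmap_dom UNIV \<psi>" "ratmap_val \<psi> y \<in> ratmap_dom X \<phi>"
      "ratmap_val \<phi> (ratmap_val \<psi> y) = y"
      using fg[OF y] dom_\<psi>[of y] dom_\<phi>[of "g y"] by simp_all
  qed
  ultimately show ?thesis
    unfolding birational_map_def \<phi>_def by blast
qed

section \<open>Derivations from polynomial vector fields\<close>

definition dir_deriv :: "('n \<Rightarrow> complex ^ 'n \<Rightarrow> complex) \<Rightarrow> (complex ^ 'n \<Rightarrow> complex) \<Rightarrow> complex ^ 'n \<Rightarrow> complex" where
  "dir_deriv v p x = (\<Sum>i\<in>UNIV. v i x * partial_deriv i p x)"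

lemma polyfun_dir_deriv:
  assumes "\<And>i. polyfun (v i)" "polyfun p"
  shows "polyfun (dir_deriv v p)"
proof -
  have "polyfun (\<lambda>x. \<Sum>i\<in>UNIV. v i x * partial_deriv i p x)"
    by (intro polyfun_sum polyfun.mult polyfun_partial_deriv assms)
  then show ?thesis by (simp add: dir_deriv_def[abs_def])
qed

lemma dir_deriv_const [simp]: "dir_deriv v (\<lambda>x. c) x = 0"
  by (simp add: dir_deriv_def partial_deriv_const)

lemma dir_deriv_coord: "dir_deriv v (\<lambda>x. x $ k) x = v k x"
  by (simp add: dir_deriv_def partial_deriv_coord if_distrib[of "\<lambda>u. _ * u"] cong: if_cong)

lemma dir_deriv_add:
  "polyfun p \<Longrightarrow> polyfun q \<Longrightarrow> dir_deriv v (\<lambda>x. p x + q x) x = dir_deriv v p x + dir_deriv v q x"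
  by (simp add: dir_deriv_def partial_deriv_add distrib_left sum.distrib)

lemma dir_deriv_mult:
  assumes "polyfun p" "polyfun q"
  shows "dir_deriv v (\<lambda>x. p x * q x) x = dir_deriv v p x * q x + p x * dir_deriv v q x"
  unfolding dir_deriv_def partial_deriv_mult[OF assms] sum_distrib_left sum_distrib_right sum.distrib[symmetric]
  by (rule sum.cong) (simp_all add: algebra_simps)

lemma dir_deriv_uminus: "polyfun p \<Longrightarrow> dir_deriv v (\<lambda>x. - p x) x = - dir_deriv v p x"
  using dir_deriv_mult[of "\<lambda>x. -1" p v x] by (simp add: polyfun.const)

lemma dir_deriv_diff:
  "polyfun p \<Longrightarrow> polyfun q \<Longrightarrow> dir_deriv v (\<lambda>x. p x - q x) x = dir_deriv v p x - dir_deriv v q x"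
  using dir_deriv_add[OF _ polyfun_uminus, of p q v x] by (simp add: dir_deriv_uminus)

text \<open>Such a vector field preserves the ideal of \<open>X\<close>, so it acts on the coordinate ring and, by the quotient
  rule, on the function field.\<close>

definition tangent :: "(complex ^ 'n) set \<Rightarrow> ('n \<Rightarrow> complex ^ 'n \<Rightarrow> complex) \<Rightarrow> bool" where
  "tangent X v \<longleftrightarrow> (\<forall>i. polyfun (v i)) \<and>
     (\<forall>p. polyfun p \<longrightarrow> (\<forall>x\<in>X. p x = 0) \<longrightarrow> (\<forall>x\<in>X. dir_deriv v p x = 0))"

definition field_deriv :: "(complex ^ 'n) set \<Rightarrow> ('n \<Rightarrow> complex ^ 'n \<Rightarrow> complex) \<Rightarrow> 'n vfield" where
  "field_deriv X v f = (\<Union>(a, b)\<in>f.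
     frac_class X (\<lambda>x. dir_deriv v a x * b x - a x * dir_deriv v b x) (\<lambda>x. b x * b x))"

context irreducible_set
begin

lemma fractions_deriv:
  assumes "tangent X v" "(a, b) \<in> fractions X"
  shows "(\<lambda>x. dir_deriv v a x * b x - a x * dir_deriv v b x, \<lambda>x. b x * b x) \<in> fractions X"
proof (rule fractions_denominator[OF assms(2) assms(2)])
  have "polyfun (v i)" for i
    using assms(1) by (simp add: tangent_def)
  then show "polyfun (\<lambda>x. dir_deriv v a x * b x - a x * dir_deriv v b x)"
    using assms(2) by (intro polyfun_diff polyfun.mult polyfun_dir_deriv) (auto simp: fractions_iff)
qed

text \<open>Independence of the representative: differentiating \<open>a b' - a' b\<close>, which vanishes on \<open>X\<close>, along a tangent
  field gives a relation from which the two quotient rules agree.\<close>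

lemma field_deriv_frac:
  assumes v: "tangent X v" and ab: "(a, b) \<in> fractions X"
  shows "field_deriv X v (fraction a b) =
    fraction (\<lambda>x. dir_deriv v a x * b x - a x * dir_deriv v b x) (\<lambda>x. b x * b x)"
    (is "_ = ?Z")
proof -
  have *: "fraction (\<lambda>x. dir_deriv v a' x * b' x - a' x * dir_deriv v b' x) (\<lambda>x. b' x * b' x) = ?Z"
    if "(a', b') \<in> fraction a b" for a' b'
  proof -
    have ab': "(a', b') \<in> fractions X" and eq: "\<And>x. x \<in> X \<Longrightarrow> a x * b' x = a' x * b x"
      using that by (auto simp: frac_class_iff)
    have polys: "polyfun a" "polyfun b" "polyfun a'" "polyfun b'"
      using ab ab' by (auto simp: fractions_iff)
    have "polyfun (\<lambda>x. a x * b' x - a' x * b x)"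
      by (intro polyfun_intros polys)
    then have d: "dir_deriv v (\<lambda>x. a x * b' x - a' x * b x) x = 0" if "x \<in> X" for x
      using v eq that unfolding tangent_def by simp
    show ?thesis
    proof (subst frac_eq_iff[OF fractions_deriv[OF v ab'] fractions_deriv[OF v ab]], rule ballI)
      fix x assume x: "x \<in> X"
      have "dir_deriv v a x * b' x + a x * dir_deriv v b' x - dir_deriv v a' x * b x - a' x * dir_deriv v b x = 0"
        using d[OF x] polys by (simp add: dir_deriv_diff dir_deriv_mult polyfun.mult)
      moreover have "(dir_deriv v a' x * b' x - a' x * dir_deriv v b' x) * (b x * b x) -
          (dir_deriv v a x * b x - a x * dir_deriv v b x) * (b' x * b' x) =
          (a x * b' x - a' x * b x) * (b' x * dir_deriv v b x + b x * dir_deriv v b' x) -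
          (dir_deriv v a x * b' x + a x * dir_deriv v b' x - dir_deriv v a' x * b x - a' x * dir_deriv v b x) * (b x * b' x)"
        by (simp add: algebra_simps)
      ultimately show "(dir_deriv v a' x * b' x - a' x * dir_deriv v b' x) * (b x * b x) =
          (dir_deriv v a x * b x - a x * dir_deriv v b x) * (b' x * b' x)"
        using eq[OF x] by simp
    qed
  qed
  have "field_deriv X v (fraction a b) = (\<Union>p\<in>fraction a b. ?Z)"
    unfolding field_deriv_def by (rule SUP_cong[OF refl]) (use * in \<open>simp add: split_beta\<close>)
  also have "\<dots> = ?Z"
    using frac_class_refl[OF ab] by auto
  finally show ?thesis .
qed

lemma field_deriv_mem_derivations:
  assumes v: "tangent X v"
  shows "field_deriv X v \<in> derivations X"
proof -
  have dc: "field_deriv X v f \<in> carrier K" if "f \<in> carrier K" for f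
    using that by (elim function_field_cases)
      (simp add: field_deriv_frac[OF v] frac_class_closed[OF fractions_deriv[OF v]])
  have add: "field_deriv X v (f \<oplus>\<^bsub>K\<^esub> g) = field_deriv X v f \<oplus>\<^bsub>K\<^esub> field_deriv X v g"
    and mult: "field_deriv X v (f \<otimes>\<^bsub>K\<^esub> g) = (f \<otimes>\<^bsub>K\<^esub> field_deriv X v g) \<oplus>\<^bsub>K\<^esub> (g \<otimes>\<^bsub>K\<^esub> field_deriv X v f)"
    if f: "f \<in> carrier K" and g: "g \<in> carrier K" for f g
  proof -
    obtain a b c d where ab: "(a, b) \<in> fractions X" "f = fraction a b"
      and cd: "(c, d) \<in> fractions X" "g = fraction c d"
      using function_field_cases[OF f] function_field_cases[OF g] by metis
    have polys: "polyfun a" "polyfun b" "polyfun c" "polyfun d"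
      using ab cd by (auto simp: fractions_iff)
    note F = ab(1) cd(1) fractions_deriv[OF v] fractions_add fractions_mult
    show "field_deriv X v (f \<oplus>\<^bsub>K\<^esub> g) = field_deriv X v f \<oplus>\<^bsub>K\<^esub> field_deriv X v g"
      unfolding ab(2) cd(2)
      by (simp add: add_frac F field_deriv_frac[OF v])
        (subst frac_eq_iff, intro F, intro F, simp add: dir_deriv_add dir_deriv_mult polys polyfun.mult algebra_simps)
    show "field_deriv X v (f \<otimes>\<^bsub>K\<^esub> g) = (f \<otimes>\<^bsub>K\<^esub> field_deriv X v g) \<oplus>\<^bsub>K\<^esub> (g \<otimes>\<^bsub>K\<^esub> field_deriv X v f)"
      unfolding ab(2) cd(2)
      by (simp add: add_frac mult_frac F field_deriv_frac[OF v])
        (subst frac_eq_iff, intro F, intro F, simp add: dir_deriv_mult polys polyfun.mult algebra_simps)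
  qed
  have "field_deriv X v (rat_const X c) = \<zero>\<^bsub>K\<^esub>" for c
    unfolding rat_const_def rat_of_polyfun_def
    by (simp add: field_deriv_frac[OF v] fractions_one polyfun.const zero_frac)
  with dc add mult show ?thesis
    unfolding derivations_def by (simp add: Let_def Pi_iff)
qed

end

section \<open>The chart of the cubic surface and its density\<close>

lemma vector_3_eq_iff: "(x :: 'a ^ 3) = y \<longleftrightarrow> x $ 1 = y $ 1 \<and> x $ 2 = y $ 2 \<and> x $ 3 = y $ 3"
  by (simp add: vec_eq_iff forall_3)

text \<open>Beyond nonvanishing, the conditions say that the points of the hyperbola \<open>x\<^sub>1 x\<^sub>2 = e\<^sub>0\<close> with \<open>x\<^sub>1\<close> equal to \<open>e\<^sub>3\<close> or \<open>1/e\<^sub>3\<close>, or with \<open>x\<^sub>2\<close>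
  equal to \<open>e\<^sub>4\<close> or \<open>1/e\<^sub>4\<close>, are four distinct points.\<close>

locale cubic_surface =
  fixes e0 e3 e4 :: complex
  assumes nz: "e0 \<noteq> 0" "e3 \<noteq> 0" "e4 \<noteq> 0"
    and simple: "e3 \<noteq> inverse e3" "e4 \<noteq> inverse e4"
    and disjoint: "e0 \<noteq> e3 * e4" "e0 \<noteq> e3 * inverse e4" "e0 \<noteq> inverse e3 * e4"
      "e0 \<noteq> inverse e3 * inverse e4"
begin

abbreviation "X \<equiv> C_V e0 e3 e4"

definition "a3 = e3 + inverse e3"
definition "a4 = e4 + inverse e4"
definition "\<theta>1 = a3 + e0 * a4"
definition "\<theta>2 = a4 + e0 * a3"

definition q :: "complex \<Rightarrow> complex \<Rightarrow> complex" where
  "q s t = s^2 + t^2 - \<theta>1 * s - \<theta>2 * t + (e0^2 + e0 * a3 * a4 + 1)"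

definition p :: "complex ^ 3 \<Rightarrow> complex" where
  "p x = x $ 1 * x $ 2 - e0"

lemma F_V_eq: "F_V e0 e3 e4 x = p x * x $ 3 + q (x $ 1) (x $ 2)"
  by (simp add: F_V_def F_poly_def Let_def p_def q_def \<theta>1_def \<theta>2_def a3_def a4_def algebra_simps)

lemma mem_X_iff: "x \<in> X \<longleftrightarrow> p x * x $ 3 + q (x $ 1) (x $ 2) = 0"
  by (simp add: C_V_def F_V_eq)

lemma polyfun_p: "polyfun p"
  unfolding p_def[abs_def] by (intro polyfun_intros)

lemma polyfun_q: "polyfun a \<Longrightarrow> polyfun b \<Longrightarrow> polyfun (\<lambda>x. q (a x) (b x))"
  unfolding q_def by (intro polyfun_intros)

lemma polyfun_F_V: "polyfun (F_V e0 e3 e4)"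
proof -
  have "polyfun (\<lambda>x. p x * x $ 3 + q (x $ 1) (x $ 2))"
    by (intro polyfun_intros polyfun_p polyfun_q)
  then show ?thesis by (simp add: F_V_eq[abs_def])
qed

definition q1 :: "complex \<Rightarrow> complex" where "q1 s = 2 * s - \<theta>1"
definition q2 :: "complex \<Rightarrow> complex" where "q2 t = 2 * t - \<theta>2"

lemma has_derivative_q:
  assumes "(f has_field_derivative f') (at r)" "(g has_field_derivative g') (at r)"
  shows "((\<lambda>r. q (f r) (g r)) has_field_derivative q1 (f r) * f' + q2 (g r) * g') (at r)"
  unfolding q_def q1_def q2_def
  by (auto intro!: derivative_eq_intros assms simp: algebra_simps)

definition grad_F :: "3 \<Rightarrow> complex ^ 3 \<Rightarrow> complex" where
  "grad_F i x = (if i = 1 then x $ 2 * x $ 3 + q1 (x $ 1)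
     else if i = 2 then x $ 1 * x $ 3 + q2 (x $ 2) else p x)"

lemma partial_deriv_F_V: "partial_deriv i (F_V e0 e3 e4) = grad_F i"
proof (rule partial_deriv_eq_gradient, rule has_gradientI)
  fix \<gamma> :: "complex \<Rightarrow> complex ^ 3" and \<gamma>' t
  assume d: "\<And>i. ((\<lambda>t. \<gamma> t $ i) has_field_derivative \<gamma>' i) (at t)"
  show "((\<lambda>t. F_V e0 e3 e4 (\<gamma> t)) has_field_derivative (\<Sum>i\<in>UNIV. grad_F i (\<gamma> t) * \<gamma>' i)) (at t)"
    unfolding F_V_eq p_def
    by (auto intro!: derivative_eq_intros has_derivative_q d simp: sum_3 grad_F_def p_def algebra_simps)
qed

lemma partial_deriv_3_F_V: "partial_deriv 3 (F_V e0 e3 e4) = p"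
  unfolding partial_deriv_F_V by (simp add: grad_F_def fun_eq_iff)

definition chart :: "complex \<Rightarrow> complex \<Rightarrow> complex ^ 3" where
  "chart s t = vector [s, t, - q s t / (s * t - e0)]"

lemma chart_nth [simp]: "chart s t $ 1 = s" "chart s t $ 2 = t" "chart s t $ 3 = - q s t / (s * t - e0)"
  by (simp_all add: chart_def)

lemma p_chart: "p (chart s t) = s * t - e0"
  by (simp add: p_def)

lemma chart_mem: "s * t \<noteq> e0 \<Longrightarrow> chart s t \<in> X"
  by (simp add: mem_X_iff p_chart)

lemma chart_coords:
  assumes "x \<in> X" "p x \<noteq> 0"
  shows "chart (x $ 1) (x $ 2) = x"
proof -
  have "q (x $ 1) (x $ 2) = - (p x * x $ 3)"
    using assms(1) by (simp add: mem_X_iff eq_neg_iff_add_eq_0 add.commute)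
  then show ?thesis
    using assms(2) by (simp add: vector_3_eq_iff p_def)
qed

text \<open>Multiplied by a power of \<open>p\<close>, the restriction of a polynomial to the chart becomes a polynomial on the
  plane, to which \<open>polyfun_mult_eq_0\<close> and the finiteness of zeros on lines apply.\<close>

lemma pullback:
  assumes "polyfun a"
  obtains G :: "complex ^ 2 \<Rightarrow> complex" and N where "polyfun G"
    "\<And>y. y $ 1 * y $ 2 \<noteq> e0 \<Longrightarrow> G y = (y $ 1 * y $ 2 - e0) ^ N * a (chart (y $ 1) (y $ 2))"
proof -
  define n :: "3 \<Rightarrow> complex ^ 2 \<Rightarrow> complex"
    where "n j = (if j = 1 then (\<lambda>y. y $ 1) else if j = 2 then (\<lambda>y. y $ 2) else (\<lambda>y. - q (y $ 1) (y $ 2)))" for j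
  define d :: "3 \<Rightarrow> complex ^ 2 \<Rightarrow> complex"
    where "d j = (if j = 3 then (\<lambda>y. y $ 1 * y $ 2 - e0) else (\<lambda>y. 1))" for j
  have "polyfun (n j)" for j
    by (cases "j = 1"; cases "j = 2") (simp_all add: n_def polyfun.coord polyfun_uminus polyfun_q)
  moreover have "polyfun (d j)" for j
    by (cases "j = 3") (simp_all add: d_def polyfun.coord polyfun.const polyfun.mult polyfun_diff)
  moreover have "(\<Prod>j\<in>UNIV. d j y) = y $ 1 * y $ 2 - e0" for y
    unfolding UNIV_3 by (simp add: d_def)
  moreover have "(\<chi> j. n j y / d j y) = chart (y $ 1) (y $ 2)" for y
    by (simp add: vector_3_eq_iff n_def d_def)
  ultimately have "\<exists>G N. polyfun G \<and> (\<forall>y :: complex ^ 2. y $ 1 * y $ 2 - e0 \<noteq> 0 \<longrightarrow>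
      G y = (y $ 1 * y $ 2 - e0) ^ N * a (chart (y $ 1) (y $ 2)))"
    using polyfun_clear_denominators[OF assms, of n d] by simp
  then obtain G N where "polyfun G" "\<forall>y :: complex ^ 2. y $ 1 * y $ 2 - e0 \<noteq> 0 \<longrightarrow>
      G y = (y $ 1 * y $ 2 - e0) ^ N * a (chart (y $ 1) (y $ 2))"
    by (elim exE conjE)
  then show thesis
    by (intro that[of G N]) simp_all
qed

text \<open>The left-hand side is the derivative of \<open>q\<close> along the field \<open>s \<partial>\<^sub>s - t \<partial>\<^sub>t\<close>, which is tangent to the hyperbola.
  On the hyperbola \<open>q\<close> agrees with \<open>(s - e\<^sub>3) (s - 1/e\<^sub>3) (t - e\<^sub>4) (t - 1/e\<^sub>4)\<close>, which has only simple zeros.\<close>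

lemma transversal:
  assumes "s * t = e0" "q s t = 0"
  shows "q1 s * s - q2 t * t \<noteq> 0"
proof -
  have q: "q s t = (s - e3) * (s - inverse e3) * ((t - e4) * (t - inverse e4))"
  proof -
    have "q s t = (s^2 - a3 * s + 1) * (t^2 - a4 * t + 1)"
      unfolding q_def \<theta>1_def \<theta>2_def unfolding assms(1)[symmetric] by (simp add: algebra_simps power2_eq_square)
    then show ?thesis
      using nz by (simp add: a3_def a4_def algebra_simps power2_eq_square)
  qed
  have d: "q1 s * s - q2 t * t = s * (2 * s - a3) * ((t - e4) * (t - inverse e4))
      - t * (2 * t - a4) * ((s - e3) * (s - inverse e3))"
  proof -
    have "q1 s * s - q2 t * t = s * (2 * s - a3) * (t^2 - a4 * t + 1) - t * (2 * t - a4) * (s^2 - a3 * s + 1)"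
      unfolding q1_def q2_def \<theta>1_def \<theta>2_def unfolding assms(1)[symmetric] by (simp add: algebra_simps power2_eq_square)
    moreover have "t^2 - a4 * t + 1 = (t - e4) * (t - inverse e4)" "s^2 - a3 * s + 1 = (s - e3) * (s - inverse e3)"
      using nz by (simp_all add: a3_def a4_def algebra_simps power2_eq_square)
    ultimately show ?thesis by simp
  qed
  have st: "s \<noteq> 0" "t \<noteq> 0"
    using assms(1) nz by auto
  from assms(2) q have "s = e3 \<or> s = inverse e3 \<or> t = e4 \<or> t = inverse e4"
    by auto
  then show ?thesis
    unfolding d using disjoint simple st assms(1) by (auto simp: a3_def a4_def)
qed

lemma has_derivative_polyfun_3:
  assumes "polyfun a" and "(f has_field_derivative f') (at r)" "(g has_field_derivative g') (at r)"
    "(h has_field_derivative h') (at r)"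
  shows "((\<lambda>r. a (vector [f r, g r, h r] :: complex ^ 3)) has_field_derivative
    partial_deriv 1 a (vector [f r, g r, h r]) * f' + partial_deriv 2 a (vector [f r, g r, h r]) * g' +
    partial_deriv 3 a (vector [f r, g r, h r]) * h') (at r)"
proof -
  let ?\<gamma>' = "\<lambda>i::3. if i = 1 then f' else if i = 2 then g' else h'"
  have "((\<lambda>r. (vector [f r, g r, h r] :: complex ^ 3) $ i) has_field_derivative ?\<gamma>' i) (at r)" for i
    using assms(2-4) exhaust_3[of i] by auto
  from polyfun_chain_rule[OF assms(1) this] show ?thesis
    by (simp add: sum_3)
qed

text \<open>A point \<open>x = (s, t, u)\<close> of the surface with \<open>p x = 0\<close> is the limit of points of the chart: along the line
  \<open>(s + \<alpha> r, t + \<beta> r)\<close> the quotient \<open>- q/p\<close> tends, for \<open>r\<close> tending to zero, to the negative of the quotient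
  of the derivatives of \<open>q\<close> and \<open>p\<close> in the direction \<open>(\<alpha>, \<beta>)\<close>. By \<open>transversal\<close> the direction can be
  chosen so that this is \<open>u\<close>.\<close>

lemma chart_dense:
  assumes a: "polyfun a" and zero: "\<And>x. x \<in> X \<Longrightarrow> p x \<noteq> 0 \<Longrightarrow> a x = 0"
  shows "\<forall>x\<in>X. a x = 0"
proof
  fix x assume x: "x \<in> X"
  show "a x = 0"
  proof (cases "p x = 0")
    case True
    define s t u where "s = x $ 1" "t = x $ 2" "u = x $ 3"
    have st: "s * t = e0" "q s t = 0"
      using x True by (simp_all add: mem_X_iff p_def s_t_u_def)
    define \<Delta> where "\<Delta> = q1 s * s - q2 t * t"
    have \<Delta>: "\<Delta> \<noteq> 0"
      unfolding \<Delta>_def by (rule transversal[OF st])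
    \<comment> \<open>Cramer's rule for the system \<open>dp\<close>, \<open>dq\<close> below.\<close>
    define \<alpha> \<beta> where "\<alpha> = - (u * s + q2 t) / \<Delta>" "\<beta> = (u * t + q1 s) / \<Delta>"
    have dp: "t * \<alpha> + s * \<beta> = 1" and dq: "q1 s * \<alpha> + q2 t * \<beta> = - u"
      using \<Delta> unfolding \<alpha>_\<beta>_def by (simp_all add: divide_simps) (simp_all add: \<Delta>_def algebra_simps)
    define w where "w r = 1 + \<alpha> * \<beta> * r" for r
    \<comment> \<open>The common factor \<open>r\<close> of \<open>p\<close> and \<open>q\<close> along the line is cancelled, which
      makes the third coordinate differentiable at zero.\<close>
    define h where "h r = (u - (\<alpha>\<^sup>2 + \<beta>\<^sup>2) * r) / w r" for r
    define \<gamma> where "\<gamma> r = (vector [s + \<alpha> * r, t + \<beta> * r, h r] :: complex ^ 3)" for r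
    have "\<gamma> 0 = x"
      by (simp add: \<gamma>_def h_def w_def vector_3_eq_iff s_t_u_def)
    have p\<gamma>: "p (\<gamma> r) = r * w r" for r
    proof -
      have "p (\<gamma> r) = s * t - e0 + (t * \<alpha> + s * \<beta>) * r + \<alpha> * \<beta> * r^2"
        by (simp add: p_def \<gamma>_def algebra_simps power2_eq_square)
      then show ?thesis
        unfolding st dp by (simp add: w_def algebra_simps power2_eq_square)
    qed
    have q\<gamma>: "q (s + \<alpha> * r) (t + \<beta> * r) = - (r * (u - (\<alpha>\<^sup>2 + \<beta>\<^sup>2) * r))" for r
    proof -
      have "q (s + \<alpha> * r) (t + \<beta> * r) = q s t + (q1 s * \<alpha> + q2 t * \<beta>) * r + (\<alpha>\<^sup>2 + \<beta>\<^sup>2) * r^2"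
        by (simp add: q_def q1_def q2_def algebra_simps power2_eq_square)
      then show ?thesis
        unfolding st dq by (simp add: algebra_simps power2_eq_square)
    qed
    have X\<gamma>: "\<gamma> r \<in> X" if "w r \<noteq> 0" for r
    proof -
      have "p (\<gamma> r) * \<gamma> r $ 3 + q (\<gamma> r $ 1) (\<gamma> r $ 2) = 0"
        unfolding p\<gamma> using that by (simp add: \<gamma>_def q\<gamma> h_def)
      then show ?thesis by (simp add: mem_X_iff)
    qed
    have w_ev: "\<forall>\<^sub>F r in at 0. w r \<noteq> 0"
    proof -
      have "w \<midarrow>0\<rightarrow> w 0"
        unfolding w_def by (intro tendsto_intros)
      then show ?thesis
        by (rule tendsto_imp_eventually_ne) (simp add: w_def)
    qed
    then have ev: "\<forall>\<^sub>F r in at 0. a (\<gamma> r) = 0"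
      using eventually_neq_at_within[of 0 0 UNIV]
    proof eventually_elim
      case (elim r)
      then show ?case using zero[OF X\<gamma>[of r]] by (simp add: p\<gamma>)
    qed
    have "\<exists>D. (h has_field_derivative D) (at 0)"
      unfolding h_def w_def by (rule exI) (rule derivative_eq_intros refl | simp)+
    then obtain D where D: "(h has_field_derivative D) (at 0)" ..
    have "((\<lambda>r. s + \<alpha> * r) has_field_derivative \<alpha>) (at 0)" "((\<lambda>r. t + \<beta> * r) has_field_derivative \<beta>) (at 0)"
      by (auto intro!: derivative_eq_intros)
    from has_derivative_polyfun_3[OF a this D] have "isCont (\<lambda>r. a (\<gamma> r)) 0"
      unfolding \<gamma>_def[symmetric] by (rule DERIV_isCont)
    then have "(\<lambda>r. a (\<gamma> r)) \<midarrow>0\<rightarrow> a x"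
      using \<open>\<gamma> 0 = x\<close> by (simp add: isCont_def)
    moreover have "(\<lambda>r. a (\<gamma> r)) \<midarrow>0\<rightarrow> 0"
      using ev by (rule tendsto_eventually)
    ultimately show "a x = 0"
      using tendsto_unique[OF trivial_limit_at] by blast
  qed (use zero x in simp)
qed

text \<open>The product of the pullbacks of \<open>a\<close> and \<open>b\<close> vanishes where \<open>p\<close> does not. A further factor \<open>p\<close> makes it
  vanish on the whole plane, so one of the pullbacks is zero off \<open>p = 0\<close>, and by density the corresponding
  polynomial vanishes on the surface.\<close>

lemma irreducible_X: "irreducible_set X"
proof
  show "X \<noteq> {}"
    using chart_mem[of 0 0] nz by auto
next
  fix a b assume ab: "polyfun a" "polyfun b" "\<And>x. x \<in> X \<Longrightarrow> a x * b x = 0"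
  obtain G :: "complex ^ 2 \<Rightarrow> complex" and N where G: "polyfun G"
    "\<And>y. y $ 1 * y $ 2 \<noteq> e0 \<Longrightarrow> G y = (y $ 1 * y $ 2 - e0) ^ N * a (chart (y $ 1) (y $ 2))"
    using pullback[OF ab(1)] by metis
  obtain H :: "complex ^ 2 \<Rightarrow> complex" and M where H: "polyfun H"
    "\<And>y. y $ 1 * y $ 2 \<noteq> e0 \<Longrightarrow> H y = (y $ 1 * y $ 2 - e0) ^ M * b (chart (y $ 1) (y $ 2))"
    using pullback[OF ab(2)] by metis
  let ?P = "\<lambda>y :: complex ^ 2. y $ 1 * y $ 2 - e0"
  have "polyfun (\<lambda>y. H y * ?P y)"
    by (intro polyfun_intros H)
  moreover have "G y * (H y * ?P y) = 0" for y
    using G(2)[of y] H(2)[of y] ab(3)[OF chart_mem[of "y $ 1" "y $ 2"]]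
    by (cases "y $ 1 * y $ 2 = e0") auto
  ultimately have "(\<forall>y. G y = 0) \<or> (\<forall>y. H y * ?P y = 0)"
    using polyfun_mult_eq_0[OF G(1)] by blast
  moreover have "\<forall>x\<in>X. a x = 0" if "\<forall>y. G y = 0"
  proof (rule chart_dense[OF ab(1)])
    fix x assume x: "x \<in> X" "p x \<noteq> 0"
    then show "a x = 0"
      using that G(2)[of "vector [x $ 1, x $ 2]"] chart_coords[OF x] by (simp add: p_def)
  qed
  moreover have "\<forall>x\<in>X. b x = 0" if "\<forall>y. H y * ?P y = 0"
  proof (rule chart_dense[OF ab(2)])
    fix x assume x: "x \<in> X" "p x \<noteq> 0"
    have "H (vector [x $ 1, x $ 2]) * p x = 0"
      using that[rule_format, of "vector [x $ 1, x $ 2]"] by (simp add: p_def)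
    then show "b x = 0"
      using x H(2)[of "vector [x $ 1, x $ 2]"] chart_coords[OF x] by (simp add: p_def)
  qed
  ultimately show "(\<forall>x\<in>X. a x = 0) \<or> (\<forall>x\<in>X. b x = 0)"
    by blast
qed

sublocale irreducible_set X
  by (rule irreducible_X)

section \<open>Tangent vector fields of the cubic surface\<close>

text \<open>In the coordinates \<open>(x\<^sub>1, x\<^sub>2)\<close> these fields are \<open>p \<partial>\<^sub>1\<close> and \<open>p \<partial>\<^sub>2\<close>; the third component is the one that makes them
  annihilate \<open>F\<close>.\<close>

definition v1 :: "3 \<Rightarrow> complex ^ 3 \<Rightarrow> complex" where
  "v1 i x = (if i = 1 then p x else if i = 2 then 0 else - grad_F 1 x)"

definition v2 :: "3 \<Rightarrow> complex ^ 3 \<Rightarrow> complex" where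
  "v2 i x = (if i = 1 then 0 else if i = 2 then p x else - grad_F 2 x)"

lemma polyfun_grad_F: "polyfun (grad_F i)"
  using polyfun_partial_deriv[OF polyfun_F_V, of i] by (simp add: partial_deriv_F_V)

lemma polyfun_v: "polyfun (v1 i)" "polyfun (v2 i)"
  using exhaust_3[of i]
  by (auto simp: v1_def[abs_def] v2_def[abs_def] polyfun_p polyfun.const polyfun_uminus polyfun_grad_F)

lemma has_derivative_along_chart:
  assumes a: "polyfun a" and nz: "(s + \<alpha> * r) * (t + \<beta> * r) \<noteq> e0"
  defines "x \<equiv> chart (s + \<alpha> * r) (t + \<beta> * r)"
  shows "((\<lambda>r. a (chart (s + \<alpha> * r) (t + \<beta> * r))) has_field_derivative
    (\<alpha> * dir_deriv v1 a x + \<beta> * dir_deriv v2 a x) / p x) (at r)"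
proof -
  let ?f = "\<lambda>r. s + \<alpha> * r" and ?g = "\<lambda>r. t + \<beta> * r"
  let ?h = "\<lambda>r. - q (?f r) (?g r) / (?f r * ?g r - e0)"
  have fg: "(?f has_field_derivative \<alpha>) (at r)" "(?g has_field_derivative \<beta>) (at r)"
    by (auto intro!: derivative_eq_intros)
  have px: "p x \<noteq> 0" "?f r * ?g r - e0 = p x"
    using nz by (simp_all add: x_def p_chart)
  have "((\<lambda>r. - q (?f r) (?g r)) has_field_derivative - (q1 (?f r) * \<alpha> + q2 (?g r) * \<beta>)) (at r)"
    by (rule DERIV_minus[OF has_derivative_q[OF fg]])
  moreover have "((\<lambda>r. ?f r * ?g r - e0) has_field_derivative \<alpha> * ?g r + \<beta> * ?f r) (at r)"
    by (auto intro!: derivative_eq_intros simp: algebra_simps)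
  ultimately have h: "(?h has_field_derivative
      (- (q1 (?f r) * \<alpha> + q2 (?g r) * \<beta>) * p x - - q (?f r) (?g r) * (\<alpha> * ?g r + \<beta> * ?f r)) / (p x * p x)) (at r)"
    using DERIV_divide[of "\<lambda>r. - q (?f r) (?g r)" _ r UNIV "\<lambda>r. ?f r * ?g r - e0"] px by simp
  have eq: "- (q1 (?f r) * \<alpha> + q2 (?g r) * \<beta>) * p x - - q (?f r) (?g r) * (\<alpha> * ?g r + \<beta> * ?f r) =
      - p x * (\<alpha> * grad_F 1 x + \<beta> * grad_F 2 x)"
  proof -
    have "q (?f r) (?g r) = - (p x * x $ 3)" "x $ 1 = ?f r" "x $ 2 = ?g r"
      using px by (simp_all add: x_def)
    then show ?thesis
      by (simp add: grad_F_def algebra_simps)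
  qed
  have "(?h has_field_derivative - (\<alpha> * grad_F 1 x + \<beta> * grad_F 2 x) / p x) (at r)"
    by (rule DERIV_cong[OF h], unfold eq) (use px(1) in \<open>simp add: divide_simps\<close>)
  from has_derivative_polyfun_3[OF a fg this]
  have "((\<lambda>r. a (chart (?f r) (?g r))) has_field_derivative
      partial_deriv 1 a x * \<alpha> + partial_deriv 2 a x * \<beta> +
      partial_deriv 3 a x * (- (\<alpha> * grad_F 1 x + \<beta> * grad_F 2 x) / p x)) (at r)"
    unfolding chart_def[symmetric] x_def .
  moreover have "partial_deriv 1 a x * \<alpha> + partial_deriv 2 a x * \<beta> +
      partial_deriv 3 a x * (- (\<alpha> * grad_F 1 x + \<beta> * grad_F 2 x) / p x) =
      (\<alpha> * dir_deriv v1 a x + \<beta> * dir_deriv v2 a x) / p x"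
    using px(1) by (simp add: dir_deriv_def sum_3 v1_def v2_def divide_simps) (simp add: algebra_simps)
  ultimately show ?thesis by simp
qed

text \<open>A polynomial vanishing on the surface is constant along the chart, so its derivatives along both
  fields vanish on the chart by \<open>has_derivative_along_chart\<close>, and everywhere by density.\<close>

lemma tangent_v: "tangent X v1" "tangent X v2"
proof -
  have *: "\<alpha> * dir_deriv v1 a x + \<beta> * dir_deriv v2 a x = 0"
    if a: "polyfun a" "\<forall>x\<in>X. a x = 0" and x: "x \<in> X" "p x \<noteq> 0" for a x \<alpha> \<beta>
  proof -
    let ?\<gamma> = "\<lambda>r. chart (x $ 1 + \<alpha> * r) (x $ 2 + \<beta> * r)"
    have "((\<lambda>r. a (?\<gamma> r)) has_field_derivative (\<alpha> * dir_deriv v1 a x + \<beta> * dir_deriv v2 a x) / p x) (at 0)"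
      using has_derivative_along_chart[OF a(1), of "x $ 1" \<alpha> 0 "x $ 2" \<beta>] x chart_coords[OF x]
      by (simp add: p_def)
    moreover have "((\<lambda>r. a (?\<gamma> r)) has_field_derivative 0) (at 0)"
    proof -
      let ?w = "\<lambda>r. (x $ 1 + \<alpha> * r) * (x $ 2 + \<beta> * r)"
      have "(?w \<longlongrightarrow> ?w 0) (nhds 0)"
        by (intro tendsto_intros tendsto_ident_at filterlim_ident)
      then have "\<forall>\<^sub>F r in nhds 0. ?w r \<noteq> e0"
        by (rule tendsto_imp_eventually_ne) (use x in \<open>simp add: p_def\<close>)
      then have "\<forall>\<^sub>F r in nhds 0. a (?\<gamma> r) = 0"
        by eventually_elim (use a(2) chart_mem in blast)
      then show ?thesis
        by (subst DERIV_cong_ev[OF refl _ refl, of _ "\<lambda>_. 0"]) auto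
    qed
    ultimately have "(\<alpha> * dir_deriv v1 a x + \<beta> * dir_deriv v2 a x) / p x = 0"
      by (rule DERIV_unique)
    with x(2) show ?thesis by simp
  qed
  have "\<forall>x\<in>X. dir_deriv v1 a x = 0" if a: "polyfun a" "\<forall>x\<in>X. a x = 0" for a
    by (rule chart_dense[OF polyfun_dir_deriv[OF polyfun_v(1) a(1)]]) (use *[OF a, of _ 1 0] in simp)
  moreover have "\<forall>x\<in>X. dir_deriv v2 a x = 0" if a: "polyfun a" "\<forall>x\<in>X. a x = 0" for a
    by (rule chart_dense[OF polyfun_dir_deriv[OF polyfun_v(2) a(1)]]) (use *[OF a, of _ 0 1] in simp)
  ultimately show "tangent X v1" "tangent X v2"
    unfolding tangent_def using polyfun_v by auto
qed

text \<open>Two generic points of the chart are joined by a complex line in the plane, on which \<open>a / b\<close> is defined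
  and has derivative zero outside a finite set. The complex line without finitely many points is
  connected, so \<open>a / b\<close> takes the same value at both points.\<close>

lemma constant_if_derivs_zero:
  assumes ab: "(a, b) \<in> fractions X"
    and d1: "\<And>x. x \<in> X \<Longrightarrow> dir_deriv v1 a x * b x - a x * dir_deriv v1 b x = 0"
    and d2: "\<And>x. x \<in> X \<Longrightarrow> dir_deriv v2 a x * b x - a x * dir_deriv v2 b x = 0"
  shows "\<exists>c. \<forall>x\<in>X. a x = c * b x"
proof -
  have polys: "polyfun a" "polyfun b"
    using ab by (auto simp: fractions_iff)
  have "\<exists>x\<in>X. p x \<noteq> 0 \<and> b x \<noteq> 0"
    using chart_dense[OF polys(2)] ab unfolding fractions_iff by blast
  then obtain x0 where x0: "x0 \<in> X" "p x0 \<noteq> 0" "b x0 \<noteq> 0"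
    by blast
  define c where "c = a x0 / b x0"
  obtain G :: "complex ^ 2 \<Rightarrow> complex" and N where G: "polyfun G"
    "\<And>y. y $ 1 * y $ 2 \<noteq> e0 \<Longrightarrow> G y = (y $ 1 * y $ 2 - e0) ^ N * b (chart (y $ 1) (y $ 2))"
    using pullback[OF polys(2)] by metis
  let ?H = "\<lambda>y :: complex ^ 2. G y * (y $ 1 * y $ 2 - e0)"
  have H: "polyfun ?H"
    by (intro polyfun_intros G)
  have generic: "a x - c * b x = 0" if x: "x \<in> X" "p x \<noteq> 0" "b x \<noteq> 0" for x
  proof -
    define \<alpha> \<beta> where "\<alpha> = x $ 1 - x0 $ 1" "\<beta> = x $ 2 - x0 $ 2"
    define \<gamma> where "\<gamma> r = chart (x0 $ 1 + \<alpha> * r) (x0 $ 2 + \<beta> * r)" for r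
    define l :: "complex \<Rightarrow> complex ^ 2"
      where "l r = (\<chi> i. vector [x0 $ 1, x0 $ 2] $ i + r * vector [\<alpha>, \<beta>] $ i)" for r
    have l: "l r $ 1 = x0 $ 1 + \<alpha> * r" "l r $ 2 = x0 $ 2 + \<beta> * r" for r
      by (simp_all add: l_def)
    have ends: "\<gamma> 0 = x0" "\<gamma> 1 = x"
      using chart_coords[OF x0(1,2)] chart_coords[OF x(1,2)] by (simp_all add: \<gamma>_def \<alpha>_\<beta>_def)
    define S where "S = {r. ?H (l r) = 0}"
    have "?H (l 0) \<noteq> 0"
      using G(2)[of "l 0"] x0 ends by (simp add: l \<gamma>_def p_def)
    then have "finite S"
      unfolding S_def l_def by (rule finite_zeros_on_line[OF H])
    have 01: "0 \<in> - S" "1 \<in> - S"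
      using G(2)[of "l 0"] G(2)[of "l 1"] x0 x ends by (simp_all add: S_def l \<gamma>_def p_def \<alpha>_\<beta>_def)
    have S: "(x0 $ 1 + \<alpha> * r) * (x0 $ 2 + \<beta> * r) \<noteq> e0" "b (\<gamma> r) \<noteq> 0" "\<gamma> r \<in> X" "p (\<gamma> r) \<noteq> 0" if "r \<notin> S" for r
    proof -
      show *: "(x0 $ 1 + \<alpha> * r) * (x0 $ 2 + \<beta> * r) \<noteq> e0"
        using that by (auto simp: S_def l)
      show "b (\<gamma> r) \<noteq> 0"
        using that * G(2)[of "l r"] by (auto simp: S_def l \<gamma>_def)
      show "\<gamma> r \<in> X" "p (\<gamma> r) \<noteq> 0"
        using * chart_mem by (auto simp: \<gamma>_def p_chart)
    qed
    have "((\<lambda>r. a (\<gamma> r) / b (\<gamma> r)) has_field_derivative 0) (at r)" if "r \<in> - S" for r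
    proof -
      note S = S[of r, simplified that[unfolded Compl_iff] simp_thms, OF TrueI]
      have der: "((\<lambda>r. a (\<gamma> r) / b (\<gamma> r)) has_field_derivative
        ((\<alpha> * dir_deriv v1 a (\<gamma> r) + \<beta> * dir_deriv v2 a (\<gamma> r)) / p (\<gamma> r) * b (\<gamma> r) -
         a (\<gamma> r) * ((\<alpha> * dir_deriv v1 b (\<gamma> r) + \<beta> * dir_deriv v2 b (\<gamma> r)) / p (\<gamma> r))) / (b (\<gamma> r) * b (\<gamma> r))) (at r)"
        using DERIV_divide[OF has_derivative_along_chart[OF polys(1) S(1)]
          has_derivative_along_chart[OF polys(2) S(1)]] S(2) unfolding \<gamma>_def by simp
      have eq: "(\<alpha> * dir_deriv v1 a (\<gamma> r) + \<beta> * dir_deriv v2 a (\<gamma> r)) / p (\<gamma> r) * b (\<gamma> r) -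
         a (\<gamma> r) * ((\<alpha> * dir_deriv v1 b (\<gamma> r) + \<beta> * dir_deriv v2 b (\<gamma> r)) / p (\<gamma> r)) =
        (\<alpha> * (dir_deriv v1 a (\<gamma> r) * b (\<gamma> r) - a (\<gamma> r) * dir_deriv v1 b (\<gamma> r)) +
         \<beta> * (dir_deriv v2 a (\<gamma> r) * b (\<gamma> r) - a (\<gamma> r) * dir_deriv v2 b (\<gamma> r))) / p (\<gamma> r)"
        using S(4) by (simp add: divide_simps) (simp add: algebra_simps)
      show ?thesis
        by (rule DERIV_cong[OF der]) (unfold eq d1[OF S(3)] d2[OF S(3)], simp)
    qed
    moreover have "connected (- S)" "open (- S)"
      using connected_open_delete_finite[OF open_UNIV connected_UNIV _ \<open>finite S\<close>] \<open>finite S\<close>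
      by (simp_all add: Compl_eq_Diff_UNIV finite_imp_closed open_Diff)
    ultimately have "(\<lambda>r. a (\<gamma> r) / b (\<gamma> r)) constant_on (- S)"
      by (intro has_field_derivative_0_imp_constant_on)
    then have "a (\<gamma> 1) / b (\<gamma> 1) = a (\<gamma> 0) / b (\<gamma> 0)"
      using 01 unfolding constant_on_def by metis
    then show ?thesis
      using x(3) by (simp add: ends c_def field_simps)
  qed
  have d: "polyfun (\<lambda>x. a x - c * b x)"
    by (intro polyfun_intros polys)
  have "(p x * (a x - c * b x)) * b x = 0" if "x \<in> X" for x
    using generic[OF that] by auto
  then have "\<forall>x\<in>X. p x * (a x - c * b x) = 0"
    by (intro cancel_denominator[OF polyfun.mult[OF polyfun_p d] ab])
  then have "\<forall>x\<in>X. a x - c * b x = 0"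
    by (intro chart_dense[OF d]) auto
  then show ?thesis
    by (intro exI[of _ c]) simp
qed

end

section \<open>Log-canonical coordinates\<close>

context cring
begin

text \<open>With \<open>i = 1/u\<close> and \<open>j = 1/z\<close> for a function \<open>z\<close> with \<open>dz = d(u v)\<close>, this is the identity
  \<open>du/u \<and> d(u v)/z = du \<and> dv/z\<close>, evaluated at a pair of vector fields \<open>D\<close>, \<open>E\<close>. The following lemma is
  \<open>d(u v)/z \<and> dv/v = du \<and> dv/z\<close>, with \<open>i = 1/v\<close>.\<close>

lemma wedge_dlog_left:
  assumes "u \<in> carrier R" "v \<in> carrier R" "i \<in> carrier R" "j \<in> carrier R" "u \<otimes> i = \<one>"
    "Du \<in> carrier R" "Dv \<in> carrier R" "Eu \<in> carrier R" "Ev \<in> carrier R"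
  shows "(i \<otimes> Du) \<otimes> (j \<otimes> (u \<otimes> Ev \<oplus> v \<otimes> Eu)) \<ominus> (i \<otimes> Eu) \<otimes> (j \<otimes> (u \<otimes> Dv \<oplus> v \<otimes> Du))
    = j \<otimes> (Du \<otimes> Ev \<ominus> Eu \<otimes> Dv)"
proof -
  have "(i \<otimes> Du) \<otimes> (j \<otimes> (u \<otimes> Ev \<oplus> v \<otimes> Eu)) \<ominus> (i \<otimes> Eu) \<otimes> (j \<otimes> (u \<otimes> Dv \<oplus> v \<otimes> Du))
    = (u \<otimes> i) \<otimes> (j \<otimes> (Du \<otimes> Ev \<ominus> Eu \<otimes> Dv))"
    using assms(1-4,6-) by algebra
  then show ?thesis
    using assms by simp
qed

lemma wedge_dlog_right:
  assumes "u \<in> carrier R" "v \<in> carrier R" "i \<in> carrier R" "j \<in> carrier R" "v \<otimes> i = \<one>"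
    "Du \<in> carrier R" "Dv \<in> carrier R" "Eu \<in> carrier R" "Ev \<in> carrier R"
  shows "(j \<otimes> (u \<otimes> Dv \<oplus> v \<otimes> Du)) \<otimes> (i \<otimes> Ev) \<ominus> (j \<otimes> (u \<otimes> Ev \<oplus> v \<otimes> Eu)) \<otimes> (i \<otimes> Dv)
    = j \<otimes> (Du \<otimes> Ev \<ominus> Eu \<otimes> Dv)"
proof -
  have "(j \<otimes> (u \<otimes> Dv \<oplus> v \<otimes> Du)) \<otimes> (i \<otimes> Ev) \<ominus> (j \<otimes> (u \<otimes> Ev \<oplus> v \<otimes> Eu)) \<otimes> (i \<otimes> Dv)
    = (v \<otimes> i) \<otimes> (j \<otimes> (Du \<otimes> Ev \<ominus> Eu \<otimes> Dv))"
    using assms(1-4,6-) by algebra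
  then show ?thesis
    using assms by simp
qed

text \<open>If \<open>i\<close>, \<open>k\<close> are the inverses of \<open>u\<close>, \<open>z\<close>, the equation is \<open>(p/u) (w/z) = p\<close>. It arises for \<open>w\<close> a
  derivative of \<open>z\<close>.\<close>

lemma solve_log_equation:
  assumes "u \<in> carrier R" "z \<in> carrier R" "w \<in> carrier R" "p \<in> carrier R"
    "i \<in> carrier R" "j \<in> carrier R" "k \<in> carrier R"
    and inv: "u \<otimes> i = \<one>" "z \<otimes> k = \<one>" "p \<otimes> j = \<one>" and eq: "(i \<otimes> p) \<otimes> (k \<otimes> w) = p"
  shows "w = u \<otimes> z"
proof -
  have "w = (u \<otimes> i) \<otimes> (z \<otimes> k) \<otimes> (p \<otimes> j) \<otimes> w"
    using assms by simp
  also have "\<dots> = (u \<otimes> z \<otimes> j) \<otimes> ((i \<otimes> p) \<otimes> (k \<otimes> w))"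
    using assms(1-7) by algebra
  also have "\<dots> = u \<otimes> z \<otimes> (p \<otimes> j)"
    unfolding eq using assms(1-7) by algebra
  finally show ?thesis
    using assms by simp
qed

end

lemma (in irreducible_set) inv_mult_one:
  assumes "f \<in> carrier K" "f \<noteq> \<zero>\<^bsub>K\<^esub>"
  shows "inv\<^bsub>K\<^esub> f \<in> carrier K" "f \<otimes>\<^bsub>K\<^esub> inv\<^bsub>K\<^esub> f = \<one>\<^bsub>K\<^esub>"
  using assms by (simp_all add: K.field_Units)

lemma wedge_eqI:
  assumes "\<And>D E. D \<in> derivations X \<Longrightarrow> E \<in> derivations X \<Longrightarrow>
    (\<alpha> D \<otimes>\<^bsub>function_field X\<^esub> \<beta> E) \<ominus>\<^bsub>function_field X\<^esub> (\<alpha> E \<otimes>\<^bsub>function_field X\<^esub> \<beta> D) = \<omega> (D, E)"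
  shows "wedge X \<alpha> \<beta> = restrict \<omega> (derivations X \<times> derivations X)"
  unfolding wedge_def Let_def by (rule restrict_ext) (use assms in auto)

lemma wedge_apply:
  assumes "D \<in> derivations X" "E \<in> derivations X"
  shows "wedge X \<alpha> \<beta> (D, E) =
    (\<alpha> D \<otimes>\<^bsub>function_field X\<^esub> \<beta> E) \<ominus>\<^bsub>function_field X\<^esub> (\<alpha> E \<otimes>\<^bsub>function_field X\<^esub> \<beta> D)"
  using assms by (simp add: wedge_def Let_def)

lemma dlog_apply: "D \<in> derivations X \<Longrightarrow> dlog X f D = inv\<^bsub>function_field X\<^esub> f \<otimes>\<^bsub>function_field X\<^esub> D f"
  by (simp add: dlog_def div_form1_def differential_def Let_def)

context cubic_surface
begin

abbreviation "y1 \<equiv> rat_coord X 1"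
abbreviation "y2 \<equiv> rat_coord X 2"
abbreviation "z1 \<equiv> rat_of_polyfun X p"

lemma y_frac: "y1 = fraction (\<lambda>x. x $ 1) (\<lambda>x. 1)" "y2 = fraction (\<lambda>x. x $ 2) (\<lambda>x. 1)"
  by (simp_all add: rat_coord_def rat_of_polyfun_def)

lemma z1_frac: "z1 = fraction p (\<lambda>x. 1)"
  by (simp add: rat_of_polyfun_def)

lemmas basic_fractions [simp] = fractions_one[OF polyfun.coord[of 1]] fractions_one[OF polyfun.coord[of 2]]
  fractions_one[OF polyfun_p] fractions_one[OF polyfun.const]

lemma carriers [simp]: "y1 \<in> carrier K" "y2 \<in> carrier K" "z1 \<in> carrier K" "rat_const X c \<in> carrier K"
  by (simp_all add: y_frac z1_frac rat_const_def rat_of_polyfun_def frac_class_closed)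

lemma chart_point_nonzero:
  obtains x where "x \<in> X" "x $ 1 \<noteq> 0" "x $ 2 \<noteq> 0" "p x \<noteq> 0"
proof -
  have "\<exists>s::complex. s \<noteq> 0 \<and> s \<noteq> e0"
    by (rule exI[of _ "2 * e0"]) (use nz in simp)
  then obtain s where "s \<noteq> 0" "s \<noteq> e0" by blast
  then show thesis
    using that[of "chart s 1"] chart_mem[of s 1] by (simp add: p_chart)
qed

lemma nonzero: "y1 \<noteq> \<zero>\<^bsub>K\<^esub>" "y2 \<noteq> \<zero>\<^bsub>K\<^esub>" "z1 \<noteq> \<zero>\<^bsub>K\<^esub>"
  using chart_point_nonzero unfolding y_frac z1_frac by (metis basic_fractions frac_eq_zero_iff)+

lemma z1_eq: "z1 = (y1 \<otimes>\<^bsub>K\<^esub> y2) \<ominus>\<^bsub>K\<^esub> rat_const X e0"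
proof -
  have "polyfun (\<lambda>x :: complex ^ 3. x $ 1 * x $ 2)"
    by (intro polyfun_intros)
  from fractions_one[OF this] show ?thesis
    unfolding y_frac z1_frac rat_const_def rat_of_polyfun_def
    by (simp add: mult_frac minus_frac p_def[abs_def])
qed

lemma derivation_z1:
  assumes "D \<in> derivations X"
  shows "D z1 = (y1 \<otimes>\<^bsub>K\<^esub> D y2) \<oplus>\<^bsub>K\<^esub> (y2 \<otimes>\<^bsub>K\<^esub> D y1)"
proof -
  have D: "f \<in> carrier K \<Longrightarrow> D f \<in> carrier K"
    "f \<in> carrier K \<Longrightarrow> g \<in> carrier K \<Longrightarrow> D (f \<oplus>\<^bsub>K\<^esub> g) = D f \<oplus>\<^bsub>K\<^esub> D g"
    "f \<in> carrier K \<Longrightarrow> g \<in> carrier K \<Longrightarrow> D (f \<otimes>\<^bsub>K\<^esub> g) = (f \<otimes>\<^bsub>K\<^esub> D g) \<oplus>\<^bsub>K\<^esub> (g \<otimes>\<^bsub>K\<^esub> D f)"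
    "D (rat_const X c) = \<zero>\<^bsub>K\<^esub>" for f g c
    using assms by (auto simp: derivations_def Let_def)
  have "\<ominus>\<^bsub>K\<^esub> rat_const X e0 = rat_const X (- e0)"
    by (simp add: rat_const_def rat_of_polyfun_def uminus_frac)
  then have "z1 = (y1 \<otimes>\<^bsub>K\<^esub> y2) \<oplus>\<^bsub>K\<^esub> rat_const X (- e0)"
    using z1_eq by (simp add: a_minus_def)
  then show ?thesis
    by (simp add: D)
qed

lemma derivation_closed: "D \<in> derivations X \<Longrightarrow> f \<in> carrier K \<Longrightarrow> D f \<in> carrier K"
  by (auto simp: derivations_def Let_def)

definition omega :: "3 form2" where
  "omega = (\<lambda>(D, E)\<in>derivations X \<times> derivations X.
     inv\<^bsub>K\<^esub> z1 \<otimes>\<^bsub>K\<^esub> ((D y1 \<otimes>\<^bsub>K\<^esub> E y2) \<ominus>\<^bsub>K\<^esub> (E y1 \<otimes>\<^bsub>K\<^esub> D y2)))"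

lemma omega_V_eq: "omega_V e0 e3 e4 = omega"
  unfolding omega_V_def omega_def Let_def div_form2_def partial_deriv_3_F_V
  by (rule restrict_ext) (auto simp: wedge_apply differential_def)

lemma wedge_y1_z1: "wedge X (dlog X y1) (dlog X z1) = omega"
  unfolding omega_def
proof (rule wedge_eqI)
  fix D E assume DE: "D \<in> derivations X" "E \<in> derivations X"
  show "dlog X y1 D \<otimes>\<^bsub>K\<^esub> dlog X z1 E \<ominus>\<^bsub>K\<^esub> dlog X y1 E \<otimes>\<^bsub>K\<^esub> dlog X z1 D =
      (case (D, E) of (D, E) \<Rightarrow> inv\<^bsub>K\<^esub> z1 \<otimes>\<^bsub>K\<^esub> (D y1 \<otimes>\<^bsub>K\<^esub> E y2 \<ominus>\<^bsub>K\<^esub> E y1 \<otimes>\<^bsub>K\<^esub> D y2))"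
    unfolding prod.case dlog_apply[OF DE(1)] dlog_apply[OF DE(2)] derivation_z1[OF DE(1)] derivation_z1[OF DE(2)]
    by (rule K.wedge_dlog_left) (use DE nonzero in \<open>auto simp: inv_mult_one derivation_closed\<close>)
qed

lemma wedge_z1_y2: "wedge X (dlog X z1) (dlog X y2) = omega"
  unfolding omega_def
proof (rule wedge_eqI)
  fix D E assume DE: "D \<in> derivations X" "E \<in> derivations X"
  show "dlog X z1 D \<otimes>\<^bsub>K\<^esub> dlog X y2 E \<ominus>\<^bsub>K\<^esub> dlog X z1 E \<otimes>\<^bsub>K\<^esub> dlog X y2 D =
      (case (D, E) of (D, E) \<Rightarrow> inv\<^bsub>K\<^esub> z1 \<otimes>\<^bsub>K\<^esub> (D y1 \<otimes>\<^bsub>K\<^esub> E y2 \<ominus>\<^bsub>K\<^esub> E y1 \<otimes>\<^bsub>K\<^esub> D y2))"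
    unfolding prod.case dlog_apply[OF DE(1)] dlog_apply[OF DE(2)] derivation_z1[OF DE(1)] derivation_z1[OF DE(2)]
    by (rule K.wedge_dlog_right) (use DE nonzero in \<open>auto simp: inv_mult_one derivation_closed\<close>)
qed

lemma X_eq: "X = {x. F_V e0 e3 e4 x = 0}"
  by (simp add: C_V_def)

text \<open>It suffices to recover \<open>x\<^sub>1 = m/n\<close> and \<open>x\<^sub>2 = m'/n'\<close> from the two coordinates, since \<open>x\<^sub>3 = - q/p\<close> is then determined.\<close>

lemma birational_via_plane:
  fixes a :: "2 \<Rightarrow> complex ^ 3 \<Rightarrow> complex" and m n m' n' h :: "complex ^ 2 \<Rightarrow> complex"
  assumes polys: "\<And>i. polyfun (a i)" "polyfun m" "polyfun n" "polyfun m'" "polyfun n'" "polyfun k" "polyfun h"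
    and k: "\<exists>x\<in>X. k x \<noteq> 0" and h: "\<exists>y. h y \<noteq> 0"
    and gf: "\<And>x y. \<lbrakk>x \<in> X; k x \<noteq> 0; \<And>i. y $ i = a i x\<rbrakk> \<Longrightarrow>
      p x \<noteq> 0 \<and> n y \<noteq> 0 \<and> n' y \<noteq> 0 \<and> m y / n y = x $ 1 \<and> m' y / n' y = x $ 2"
    and fg: "\<And>y. h y \<noteq> 0 \<Longrightarrow> n y \<noteq> 0 \<and> n' y \<noteq> 0 \<and> m y / n y * (m' y / n' y) \<noteq> e0 \<and>
      (\<forall>i. a i (chart (m y / n y) (m' y / n' y)) = y $ i)"
  shows "birational_map X (UNIV :: (complex ^ 2) set) (\<lambda>i. fraction (a i) (\<lambda>x. 1))"
proof -
  define r where "r = (\<lambda>y. m y * m' y - e0 * n y * n' y)"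
  \<comment> \<open>The third fraction is \<open>- q/p\<close> at \<open>(m/n, m'/n')\<close>, with both terms multiplied by \<open>(n n')\<^sup>2\<close>.\<close>
  define c :: "3 \<Rightarrow> complex ^ 2 \<Rightarrow> complex" where
    "c j = (if j = 1 then m else if j = 2 then m'
      else (\<lambda>y. - ((m y * n' y)^2 + (m' y * n y)^2 - \<theta>1 * m y * n y * (n' y)^2 - \<theta>2 * m' y * n' y * (n y)^2
        + (e0^2 + e0 * a3 * a4 + 1) * (n y * n' y)^2)))" for j
  define d :: "3 \<Rightarrow> complex ^ 2 \<Rightarrow> complex" where
    "d j = (if j = 1 then n else if j = 2 then n' else (\<lambda>y. n y * n' y * r y))" for j
  have r: "r y = n y * n' y * (m y / n y * (m' y / n' y) - e0)" if "n y \<noteq> 0" "n' y \<noteq> 0" for y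
    using that by (simp add: r_def field_simps)
  have g: "(\<chi> j. c j y / d j y) = chart (m y / n y) (m' y / n' y)" if y: "n y \<noteq> 0" "n' y \<noteq> 0" for y
  proof -
    have "c 3 y = - ((n y * n' y)^2 * q (m y / n y) (m' y / n' y))"
      using y by (simp add: c_def q_def field_simps power2_eq_square)
    moreover have "d 3 y = (n y * n' y)^2 * (m y / n y * (m' y / n' y) - e0)"
      by (simp add: d_def r[OF y] power2_eq_square)
    ultimately have "c 3 y / d 3 y = - q (m y / n y) (m' y / n' y) / (m y / n y * (m' y / n' y) - e0)"
      using y by simp
    then show ?thesis
      by (simp add: vector_3_eq_iff) (simp add: c_def d_def)
  qed
  have d_nz: "\<forall>j. d j y \<noteq> 0" if "n y \<noteq> 0" "n' y \<noteq> 0" "m y / n y * (m' y / n' y) \<noteq> e0" for y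
    using that r[of y] by (simp add: d_def)
  have "birational_map {x. F_V e0 e3 e4 x = 0} UNIV (\<lambda>i. frac_class {x. F_V e0 e3 e4 x = 0} (a i) (\<lambda>x. 1))"
  proof (rule birational_map_affineI[where c = c and d = d and k = k and h = h], unfold X_eq[symmetric])
    show "polyfun (c j)" for j
      using exhaust_3[of j] by (elim disjE; simp add: c_def polys; intro polyfun_intros polys)
    have "polyfun r"
      unfolding r_def by (intro polyfun_intros polys)
    then show "polyfun (d j)" for j
      using exhaust_3[of j] by (elim disjE; simp add: d_def polys; intro polyfun_intros polys)
  next
    fix x assume x: "x \<in> X" "k x \<noteq> 0"
    let ?y = "(\<chi> i. a i x / 1) :: complex ^ 2"
    have y: "p x \<noteq> 0" "n ?y \<noteq> 0" "n' ?y \<noteq> 0" "m ?y / n ?y = x $ 1" "m' ?y / n' ?y = x $ 2"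
      using gf[OF x, of ?y] by simp_all
    have ne: "m ?y / n ?y * (m' ?y / n' ?y) \<noteq> e0"
      unfolding y(4,5) using y(1) by (simp add: p_def)
    show "(\<forall>i::2. (1::complex) \<noteq> 0) \<and> (\<forall>j. d j ?y \<noteq> 0) \<and> (\<chi> j. c j ?y / d j ?y) = x"
      using g[OF y(2,3)] d_nz[OF y(2,3) ne] chart_coords[OF x(1) y(1)] y(4,5) by simp
  next
    fix y assume "h y \<noteq> 0"
    from fg[OF this] have y: "n y \<noteq> 0" "n' y \<noteq> 0" "m y / n y * (m' y / n' y) \<noteq> e0"
      "\<forall>i. a i (chart (m y / n y) (m' y / n' y)) = y $ i"
      by blast+
    show "(\<forall>j. d j y \<noteq> 0) \<and> (\<chi> j. c j y / d j y) \<in> X \<and> (\<forall>i::2. (1::complex) \<noteq> 0)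
        \<and> (\<chi> i. a i (\<chi> j. c j y / d j y) / 1) = y"
      using d_nz[OF y(1-3)] chart_mem[OF y(3)] y(4) by (simp add: g[OF y(1,2)] vec_eq_iff)
  qed (use polys k h in \<open>simp_all add: polyfun_F_V fractions_one\<close>)
  then show ?thesis
    by (simp add: X_eq[symmetric])
qed

lemma birational_y1_z1: "birational_map X (UNIV :: (complex ^ 2) set) (\<lambda>i. if i = 1 then y1 else z1)"
proof -
  have "birational_map X (UNIV :: (complex ^ 2) set) (\<lambda>i. fraction (if i = 1 then (\<lambda>x. x $ 1) else p) (\<lambda>x. 1))"
  proof (rule birational_via_plane[where m = "\<lambda>y. y $ 1" and n = "\<lambda>y. 1" and m' = "\<lambda>y. y $ 2 + e0" and n' = "\<lambda>y. y $ 1"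
        and k = "\<lambda>x. x $ 1 * p x" and h = "\<lambda>y. y $ 1 * y $ 2"])
    show "\<exists>x\<in>X. x $ 1 * p x \<noteq> 0"
      using chart_point_nonzero by (metis mult_eq_0_iff)
    show "\<exists>y :: complex ^ 2. y $ 1 * y $ 2 \<noteq> 0"
      by (rule exI[of _ "\<chi> i. 1"]) simp
  qed (intro polyfun_intros polyfun_p | simp add: polyfun.coord polyfun_p p_chart p_def forall_2)+
  then show ?thesis
    by (simp add: y_frac z1_frac if_distrib[of "\<lambda>a. fraction a _"] cong: if_cong)
qed

lemma birational_z1_y2: "birational_map X (UNIV :: (complex ^ 2) set) (\<lambda>i. if i = 1 then z1 else y2)"
proof -
  have "birational_map X (UNIV :: (complex ^ 2) set) (\<lambda>i. fraction (if i = 1 then p else (\<lambda>x. x $ 2)) (\<lambda>x. 1))"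
  proof (rule birational_via_plane[where m = "\<lambda>y. y $ 1 + e0" and n = "\<lambda>y. y $ 2" and m' = "\<lambda>y. y $ 2" and n' = "\<lambda>y. 1"
        and k = "\<lambda>x. x $ 2 * p x" and h = "\<lambda>y. y $ 1 * y $ 2"])
    show "\<exists>x\<in>X. x $ 2 * p x \<noteq> 0"
      using chart_point_nonzero by (metis mult_eq_0_iff)
    show "\<exists>y :: complex ^ 2. y $ 1 * y $ 2 \<noteq> 0"
      by (rule exI[of _ "\<chi> i. 1"]) simp
  qed (intro polyfun_intros polyfun_p | simp add: polyfun.coord polyfun_p p_chart p_def forall_2)+
  then show ?thesis
    by (simp add: y_frac z1_frac if_distrib[of "\<lambda>a. fraction a _"] cong: if_cong)
qed

lemma field_deriv_y:
  "field_deriv X v1 y1 = z1" "field_deriv X v1 y2 = \<zero>\<^bsub>K\<^esub>"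
  "field_deriv X v2 y1 = \<zero>\<^bsub>K\<^esub>" "field_deriv X v2 y2 = z1"
  unfolding y_frac z1_frac zero_frac
  by (simp_all add: field_deriv_frac tangent_v dir_deriv_coord v1_def v2_def)

lemma dir_deriv_p: "dir_deriv v1 p x = p x * x $ 2" "dir_deriv v2 p x = p x * x $ 1"
proof -
  have "dir_deriv v p x = v 1 x * x $ 2 + x $ 1 * v 2 x" for v
    unfolding p_def[abs_def]
    by (subst dir_deriv_diff)
      (simp_all add: dir_deriv_mult polyfun.coord polyfun.const polyfun.mult dir_deriv_coord)
  then show "dir_deriv v1 p x = p x * x $ 2" "dir_deriv v2 p x = p x * x $ 1"
    by (simp_all add: v1_def v2_def)
qed

text \<open>The value of \<open>\<omega>\<close> on the fields \<open>v1\<close>, \<open>v2\<close> is \<open>p\<close>. Evaluating the two equations of forms on this pair gives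
  the derivatives of \<open>z\<close> along \<open>v1\<close> and \<open>v2\<close> as \<open>x\<^sub>2 z\<close> and \<open>x\<^sub>1 z\<close>; those of \<open>p\<close> are \<open>x\<^sub>2 p\<close> and \<open>x\<^sub>1 p\<close>. So \<open>z/p\<close>
  has derivative zero along both fields.\<close>

lemma unique_up_to_constant:
  assumes z: "z \<in> carrier K" and "z \<noteq> \<zero>\<^bsub>K\<^esub>"
    and w1: "wedge X (dlog X y1) (dlog X z) = omega" and w2: "wedge X (dlog X z) (dlog X y2) = omega"
  shows "\<exists>c. c \<noteq> 0 \<and> z = rat_const X c \<otimes>\<^bsub>K\<^esub> z1"
proof -
  let ?D = "field_deriv X v1" and ?E = "field_deriv X v2"
  note DE = field_deriv_mem_derivations[OF tangent_v(1)] field_deriv_mem_derivations[OF tangent_v(2)]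
  note cl = derivation_closed[OF DE(1)] derivation_closed[OF DE(2)]
  note inv = inv_mult_one[OF _ nonzero(1)] inv_mult_one[OF _ nonzero(2)] inv_mult_one[OF _ nonzero(3)]
    inv_mult_one[OF z \<open>z \<noteq> _\<close>]
  have om: "omega (?D, ?E) = z1"
  proof -
    have "omega (?D, ?E) = (z1 \<otimes>\<^bsub>K\<^esub> inv\<^bsub>K\<^esub> z1) \<otimes>\<^bsub>K\<^esub> z1"
      using DE inv by (simp add: omega_def field_deriv_y a_minus_def K.m_ac)
    then show ?thesis using inv by simp
  qed
  have Ez: "?E z = y1 \<otimes>\<^bsub>K\<^esub> z"
  proof (rule K.solve_log_equation[where p = z1])
    show "(inv\<^bsub>K\<^esub> y1 \<otimes>\<^bsub>K\<^esub> z1) \<otimes>\<^bsub>K\<^esub> (inv\<^bsub>K\<^esub> z \<otimes>\<^bsub>K\<^esub> ?E z) = z1"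
      using fun_cong[OF w1, of "(?D, ?E)"] DE inv z cl
      by (simp add: om wedge_apply dlog_apply field_deriv_y a_minus_def)
  qed (use inv z cl in auto)
  have Dz: "?D z = y2 \<otimes>\<^bsub>K\<^esub> z"
  proof (rule K.solve_log_equation[where p = z1])
    have "(inv\<^bsub>K\<^esub> z \<otimes>\<^bsub>K\<^esub> ?D z) \<otimes>\<^bsub>K\<^esub> (inv\<^bsub>K\<^esub> y2 \<otimes>\<^bsub>K\<^esub> z1) = z1"
      using fun_cong[OF w2, of "(?D, ?E)"] DE inv z cl
      by (simp add: om wedge_apply dlog_apply field_deriv_y a_minus_def)
    then show "(inv\<^bsub>K\<^esub> y2 \<otimes>\<^bsub>K\<^esub> z1) \<otimes>\<^bsub>K\<^esub> (inv\<^bsub>K\<^esub> z \<otimes>\<^bsub>K\<^esub> ?D z) = z1"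
      using inv z cl by (simp add: K.m_comm)
  qed (use inv z cl in auto)
  obtain a b where ab: "(a, b) \<in> fractions X" "z = fraction a b"
    using function_field_cases[OF z] .
  have polys: "polyfun a" "polyfun b"
    using ab(1) by (auto simp: fractions_iff)
  \<comment> \<open>The equation for the derivative of \<open>z = a/b\<close>, read as an identity of polynomials on \<open>X\<close>.\<close>
  have log_deriv: "dir_deriv v a x * b x - a x * dir_deriv v b x - g x * a x * b x = 0"
    if v: "tangent X v" and g: "polyfun g" and eq: "field_deriv X v z = fraction g (\<lambda>x. 1) \<otimes>\<^bsub>K\<^esub> z"
      and x: "x \<in> X" for v g x
  proof -
    let ?n = "\<lambda>x. dir_deriv v a x * b x - a x * dir_deriv v b x"
    have "polyfun (v i)" for i
      using v by (simp add: tangent_def)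
    then have n: "polyfun (\<lambda>x. ?n x - g x * a x * b x)"
      by (intro polyfun_intros polys g polyfun_dir_deriv)
    have ga: "(\<lambda>x. g x * a x, b) \<in> fractions X"
      using fractions_mult[OF fractions_one[OF g] ab(1)] by simp
    have "fraction ?n (\<lambda>x. b x * b x) = fraction (\<lambda>x. g x * a x) b"
      using eq ab fractions_one[OF g] by (simp add: field_deriv_frac[OF v] mult_frac)
    then have "\<forall>x\<in>X. ?n x * b x = g x * a x * (b x * b x)"
      by (subst (asm) frac_eq_iff[OF fractions_deriv[OF v ab(1)] ga])
    then have "(?n x - g x * a x * b x) * b x = 0" if "x \<in> X" for x
      using that by (simp add: algebra_simps)
    then show ?thesis
      using cancel_denominator[OF n ab(1)] x by blast
  qed
  have d1: "dir_deriv v1 a x * b x - a x * dir_deriv v1 b x - x $ 2 * a x * b x = 0" if "x \<in> X" for x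
    by (rule log_deriv[OF tangent_v(1) polyfun.coord _ that]) (use Dz y_frac in simp)
  have d2: "dir_deriv v2 a x * b x - a x * dir_deriv v2 b x - x $ 1 * a x * b x = 0" if "x \<in> X" for x
    by (rule log_deriv[OF tangent_v(2) polyfun.coord _ that]) (use Ez y_frac in simp)
  have "\<exists>x\<in>X. p x * b x \<noteq> 0"
    using chart_dense[OF polys(2)] ab(1) unfolding fractions_iff by (metis mult_eq_0_iff)
  then have "(a, \<lambda>x. p x * b x) \<in> fractions X"
    using polys polyfun_p by (simp add: fractions_iff polyfun.mult)
  then have "\<exists>c. \<forall>x\<in>X. a x = c * (p x * b x)"
  proof (rule constant_if_derivs_zero)
    fix x assume x: "x \<in> X"
    have "dir_deriv v1 a x * (p x * b x) - a x * dir_deriv v1 (\<lambda>x. p x * b x) x =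
      p x * (dir_deriv v1 a x * b x - a x * dir_deriv v1 b x - x $ 2 * a x * b x)"
      by (simp add: dir_deriv_mult polys polyfun_p dir_deriv_p algebra_simps)
    then show "dir_deriv v1 a x * (p x * b x) - a x * dir_deriv v1 (\<lambda>x. p x * b x) x = 0"
      using d1[OF x] by simp
    have "dir_deriv v2 a x * (p x * b x) - a x * dir_deriv v2 (\<lambda>x. p x * b x) x =
      p x * (dir_deriv v2 a x * b x - a x * dir_deriv v2 b x - x $ 1 * a x * b x)"
      by (simp add: dir_deriv_mult polys polyfun_p dir_deriv_p algebra_simps)
    then show "dir_deriv v2 a x * (p x * b x) - a x * dir_deriv v2 (\<lambda>x. p x * b x) x = 0"
      using d2[OF x] by simp
  qed
  then obtain c where c: "\<And>x. x \<in> X \<Longrightarrow> a x = c * (p x * b x)"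
    by blast
  have "polyfun (\<lambda>x. c * p x)"
    by (intro polyfun_intros polyfun_p)
  note cp = fractions_one[OF this]
  have "z = rat_const X c \<otimes>\<^bsub>K\<^esub> z1"
    unfolding ab(2) z1_frac rat_const_def rat_of_polyfun_def
    by (simp add: mult_frac frac_eq_iff[OF ab(1) cp] c)
  moreover have "c \<noteq> 0"
    using \<open>z \<noteq> _\<close> c frac_eq_zero_iff[OF ab(1)] by (auto simp: ab(2))
  ultimately show ?thesis by blast
qed

end

theorem proposition3p25:
  fixes e0 e3 e4 :: complex
  assumes "e0 \<noteq> 0" "e3 \<noteq> 0" "e4 \<noteq> 0"
    and "e0 \<noteq> 1" "e0 \<noteq> -1" "e3 \<noteq> 1" "e3 \<noteq> -1" "e4 \<noteq> 1" "e4 \<noteq> -1"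
    and "\<forall>\<epsilon>3\<in>{1, -1::int}. \<forall>\<epsilon>4\<in>{1, -1::int}. e0 * e3 powi \<epsilon>3 * e4 powi \<epsilon>4 \<noteq> 1"
  shows
    "let X = C_V e0 e3 e4; K = function_field X; \<omega> = omega_V e0 e3 e4;
         y1 = rat_coord X 1; y2 = rat_coord X 2;
         z1 = rat_of_polyfun X (partial_deriv 3 (F_V e0 e3 e4))
     in z1 = (rat_coord X 1 \<otimes>\<^bsub>K\<^esub> rat_coord X 2) \<ominus>\<^bsub>K\<^esub> rat_const X e0 \<and>
        log_canonical X \<omega> y1 z1 \<and> log_canonical X \<omega> z1 y2 \<and>
        (\<forall>z\<in>carrier K. log_canonical X \<omega> y1 z \<and> log_canonical X \<omega> z y2 \<longrightarrow>
           (\<exists>c. c \<noteq> 0 \<and> z = rat_const X c \<otimes>\<^bsub>K\<^esub> z1))"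
proof -
  have inv: "e \<noteq> inverse e" if "e \<noteq> 0" "e \<noteq> 1" "e \<noteq> -1" for e :: complex
  proof
    assume "e = inverse e"
    then have "(e - 1) * (e + 1) = 0"
      using that by (simp add: field_simps)
    then show False
      using that by (simp add: eq_neg_iff_add_eq_0)
  qed
  interpret S: cubic_surface e0 e3 e4
  proof
    show "e0 \<noteq> 0" "e3 \<noteq> 0" "e4 \<noteq> 0" by fact+
    show "e3 \<noteq> inverse e3" "e4 \<noteq> inverse e4"
      using inv assms by auto
    show "e0 \<noteq> e3 * e4" "e0 \<noteq> e3 * inverse e4" "e0 \<noteq> inverse e3 * e4" "e0 \<noteq> inverse e3 * inverse e4"
      using assms(2,3,10) by (auto simp: power_int_minus field_simps)
  qed
  have "\<exists>c. c \<noteq> 0 \<and> z = rat_const S.X c \<otimes>\<^bsub>S.K\<^esub> S.z1"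
    if "z \<in> carrier S.K" "log_canonical S.X S.omega S.y1 z" "log_canonical S.X S.omega z S.y2" for z
  proof (rule S.unique_up_to_constant[OF that(1)])
    have "birational_map S.X (UNIV :: (complex ^ 2) set) (\<lambda>i. if i = 1 then S.y1 else z)"
      using that(2) by (simp add: log_canonical_def)
    from birational_map_component_nonzero[OF this, of 2] show "z \<noteq> \<zero>\<^bsub>S.K\<^esub>"
      by simp
  qed (use that in \<open>simp_all add: log_canonical_def\<close>)
  moreover have "log_canonical S.X S.omega S.y1 S.z1"
    by (simp add: log_canonical_def S.wedge_y1_z1 S.birational_y1_z1)
  moreover have "log_canonical S.X S.omega S.z1 S.y2"
    by (simp add: log_canonical_def S.wedge_z1_y2 S.birational_z1_y2)
  ultimately show ?thesis
    unfolding Let_def S.partial_deriv_3_F_V S.omega_V_eq using S.z1_eq by blast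
qed

end
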